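(* Let $a,b\in\mathbb{R}\setminus\{0\}$ with $a+b\neq0$, and put $c=-(a+b)$. Let $H(3,1)$ be the 7-dimensional generalized Heisenberg group with left-invariant coframe $$e^1=\tfrac1adx_1,\ e^2=dy_1,\ e^3=\tfrac1bdx_2,\ e^4=dy_2,\ e^5=\tfrac1cdx_3,\ e^6=dy_3,\ e^7=x_1dy_1+x_2dy_2+x_3dy_3-dz,$$ so that $de^1=\dots=de^6=0$ and $de^7=a\,e^{12}+b\,e^{34}-(a+b)e^{56}$. Let $N(3,1)=\Gamma(3,1)\backslash H(3,1)$, where $\Gamma(3,1)$ is the subgroup of matrices with integer entries, with the $G_2$-structure $$\Theta=(e^{12}+e^{34}+e^{56})\wedge e^7+e^{135}-e^{146}-e^{236}-e^{245}$$ (cocalibrated of pure type), $T=-*d\Theta$ and $\nabla^+=\nabla^g+\frac12T$. For $\lambda,\mu,\tau\in\mathbb{R}$ let $A_{\lambda,\mu,\tau}$ be the linear connection on $N(3,1)$ with connection forms $$\sigma^1_2=-\sigma^2_1=\lambda e^7,\quad \sigma^3_4=-\sigma^4_3=\mu e^7,\quad \sigma^5_6=-\sigma^6_5=\tau e^7,$$ the remaining $\sigma^i_j$ being zero. If $(\lambda,\mu,\tau)\neq(0,0,0)$ satisfies $\lambda^2+\mu^2+\tau^2<2(a^2+ab+b^2)$, then $$dT=2\pi^2\alpha'\big(p_1(\nabla^+)-p_1(A_{\lambda,\mu,\tau})\big),\qquad \alpha'=4\big(2(a^2+ab+b^2)-\lambda^2-\mu^2-\tau^2\big)^{-1}>0.$$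 Therefore $(N(3,1),\Theta,\nabla^+,A_{\lambda,\mu,\tau})$ is a compact solution to the heterotic Killing spinor equations (constant dilaton, flux $H=T$) obeying the anomaly cancellation condition and solving the heterotic equations of motion. The Riemannian metric is locally given by $$g=\tfrac1{a^2}dx_1^2+dy_1^2+\tfrac1{b^2}dx_2^2+dy_2^2+\tfrac1{(a+b)^2}dx_3^2+dy_3^2+(x_1dy_1+x_2dy_2+x_3dy_3-dz)^2.$$
   Context: $H(3,1)$ is the group of real $5\times5$ matrices $$\begin{pmatrix}1&x_1&x_2&x_3&z\\0&1&0&0&y_1\\0&0&1&0&y_2\\0&0&0&1&y_3\\0&0&0&0&1\end{pmatrix}.$$ $e^{ij\dots}=e^i\wedge e^j\wedge\cdots$; metric $g=\sum_ie^i\otimes e^i$, orientation $e^{1\cdots7}$, $\nabla^g$ Levi-Civita; $g(\nabla^+_XY,Z)=g(\nabla^g_XY,Z)+\frac12T(X,Y,Z)$. With $\{E_i\}$ the dual frame, connection forms are defined by $\nabla_XE_j=\sigma^i_j(X)E_i$; curvature $\Omega^i_j=d\sigma^i_j+\sigma^i_k\wedge\sigma^k_j$; $p_1(\nabla)=\frac1{8\pi^2}\sum_{i<j}\Omega^i_j\wedge\Omega^i_j$. The heterotic Killing spinor equations (existence of a nonzero real spinor $\epsilon$, the one defining $\Theta$, with $\nabla^+\epsilon=0$, $(d\phi-\frac12H)\cdot\epsilon=0$, $F^A\cdot\epsilon=0$) with constant dilaton amount, in dimension 7, to: $d*\Theta=0$ and $d\Theta\wedge\Theta=0$ (cocalibrated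 of pure type), $H=T=-*d\Theta$, and $A$ is a $G_2$-instanton, i.e. its curvature 2-forms $\beta$ satisfy $\beta\wedge*\Theta=0$. Anomaly cancellation: $dT=2\pi^2\alpha'(p_1(\nabla^+)-p_1(A))$, $\alpha'>0$. The heterotic equations of motion (constant dilaton, curvature $R=R^+$ of $\nabla^+$) are, with full summation over repeated orthonormal indices and $R_{ijkl}=g(R(E_i,E_j)E_k,E_l)$ (same index convention for the curvature $F^A$ of $A$: first two indices are form indices), $$Ric^g_{ij}-\tfrac14H_{imn}H_j{}^{mn}-\tfrac{\alpha'}{4}\big[(F^A)_{imab}(F^A)_j{}^{mab}-R_{imnq}R_j{}^{mnq}\big]=0,\quad \nabla^g_iH^i{}_{jk}=0,\quad \nabla^+_i(F^A)^i{}_j=0,$$ where $Ric^g$ is the Ricci tensor of $\nabla^g$, the last derivative being $\nabla^+$ on form indices coupled to $A$ on the bundle indices.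
   Formalization: In the Einstein equation the skew bundle indices of the two quadratic curvature terms are summed over a<b, as in p_1, not over all ordered pairs; with full summation and the stated α' the (1,1) component equals a^2 ≠ 0, so the literal claim fails for all parameters. *)

theory Defs
  imports
    "HOL-Analysis.Analysis"
    "HOL-Library.Function_Algebras"
    "HOL-Algebra.Coset"
begin

section \<open>The group \<open>H(3,1)\<close>, the lattice and the compact quotient\<close>

text \<open>Global coordinates \<open>(x, y, z)\<close> on \<open>H(3,1)\<close>. Fields on \<open>H(3,1)\<close> are written in this chart.\<close>

type_synonym chart = "(real^3) \<times> (real^3) \<times> real"

definition heis_mat :: "chart \<Rightarrow> real^5^5" where
  "heis_mat p = (case p of (x, y, z) \<Rightarrow> vector
     [vector [1, x $ 1, x $ 2, x $ 3, z],
      vector [0, 1, 0, 0, y $ 1],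
      vector [0, 0, 1, 0, y $ 2],
      vector [0, 0, 0, 1, y $ 3],
      vector [0, 0, 0, 0, 1]])"

definition heis_group :: "(real^5^5) monoid" where
  "heis_group = \<lparr>carrier = range heis_mat, mult = (**), one = mat 1\<rparr>"

definition heis_lattice :: "(real^5^5) set" where
  "heis_lattice = {M \<in> carrier heis_group. \<forall>i j. M $ i $ j \<in> \<int>}"

text \<open>\<open>N(3,1)\<close>: the set of cosets \<open>\<Gamma>(3,1) M\<close> with the quotient topology of \<open>H(3,1)\<close>.\<close>

definition heis_nilmanifold :: "(real^5^5) set topology" where
  "heis_nilmanifold = topology (\<lambda>U. U \<subseteq> rcosets\<^bsub>heis_group\<^esub> heis_lattice \<and>
     openin (top_of_set (carrier heis_group))
       {M \<in> carrier heis_group. heis_lattice #>\<^bsub>heis_group\<^esub> M \<in> U})"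

definition left_trans :: "real^5^5 \<Rightarrow> chart \<Rightarrow> chart" where
  "left_trans M p = inv_into UNIV heis_mat (M ** heis_mat p)"


section \<open>Differential forms\<close>

text \<open>
  A \<open>k\<close>-form is represented by its values on lists of vectors, and vanishes on lists whose length
  is not \<open>k\<close>; sums, differences and \<open>0\<close> are pointwise (\<open>Function_Algebras\<close>).
\<close>

type_synonym 'v form = "'v \<Rightarrow> 'v list \<Rightarrow> real"

definition fn_form :: "('v \<Rightarrow> real) \<Rightarrow> 'v form" where
  "fn_form f p vs = (if vs = [] then f p else 0)"

definition fmult :: "('v \<Rightarrow> real) \<Rightarrow> 'v form \<Rightarrow> 'v form" where
  "fmult f \<omega> p vs = f p * \<omega> p vs"

abbreviation smult_form :: "real \<Rightarrow> 'v form \<Rightarrow> 'v form" where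
  "smult_form r \<equiv> fmult (\<lambda>_. r)"

definition one_form :: "'v::real_vector form \<Rightarrow> bool" where
  "one_form \<omega> \<longleftrightarrow> (\<forall>p. linear (\<lambda>v. \<omega> p [v]) \<and> (\<forall>vs. length vs \<noteq> 1 \<longrightarrow> \<omega> p vs = 0))"

text \<open>
  Shuffle formula. The positions in \<open>A\<close> go to \<open>\<omega>\<close>, the others to \<open>\<eta>\<close>; the exponent counts the
  inversions of the shuffle. Thus \<open>(e\<^sup>1 \<and> e\<^sup>2)(E\<^sub>1, E\<^sub>2) = 1\<close>.
\<close>

definition wedge :: "'v form \<Rightarrow> 'v form \<Rightarrow> 'v form" (infixr \<open>\<and>\<^sub>f\<close> 70) where
  "(\<omega> \<and>\<^sub>f \<eta>) p vs =
     (\<Sum>A\<in>Pow {..<length vs}.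
        (-1) ^ card {(i, j). i \<in> A \<and> j \<in> {..<length vs} - A \<and> j < i}
        * \<omega> p (nths vs A) * \<eta> p (nths vs (- A)))"

definition wedge_list :: "'v form list \<Rightarrow> 'v form" where
  "wedge_list \<omega>s = foldr wedge \<omega>s (fn_form (\<lambda>_. 1))"

definition ext_d :: "'v::real_normed_vector form \<Rightarrow> 'v form" where
  "ext_d \<omega> p vs = (\<Sum>i<length vs. (-1) ^ i *
     frechet_derivative (\<lambda>q. \<omega> q (take i vs @ drop (Suc i) vs)) (at p) (vs ! i))"

definition pullback :: "('v::real_normed_vector \<Rightarrow> 'v) \<Rightarrow> 'v form \<Rightarrow> 'v form" where
  "pullback f \<omega> p vs = \<omega> (f p) (map (frechet_derivative f (at p)) vs)"

definition trans_invariant :: "(real^5^5) set \<Rightarrow> chart form \<Rightarrow> bool" where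
  "trans_invariant S \<omega> \<longleftrightarrow> (\<forall>M\<in>S. pullback (left_trans M) \<omega> = \<omega>)"


section \<open>Riemannian geometry of a coframe in dimension 7\<close>

text \<open>
  \<open>e 1, \<dots>, e 7\<close> is a global coframe, declared orthonormal and positively oriented. Indices range
  over \<open>{1..7}\<close>.
\<close>

definition frame :: "(nat \<Rightarrow> 'v form) \<Rightarrow> nat \<Rightarrow> 'v \<Rightarrow> 'v" where
  "frame e i p = (THE v. \<forall>j\<in>{1..7}. e j p [v] = (if j = i then 1 else 0))"

definition frame_comp :: "(nat \<Rightarrow> 'v form) \<Rightarrow> 'v form \<Rightarrow> nat list \<Rightarrow> 'v \<Rightarrow> real" where
  "frame_comp e \<omega> is p = \<omega> p (map (\<lambda>i. frame e i p) is)"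

definition coframe_prod :: "(nat \<Rightarrow> 'v form) \<Rightarrow> nat list \<Rightarrow> 'v form" where
  "coframe_prod e is = wedge_list (map e is)"

definition metric :: "(nat \<Rightarrow> 'v form) \<Rightarrow> 'v \<Rightarrow> 'v \<Rightarrow> 'v \<Rightarrow> real" where
  "metric e p u v = (\<Sum>i=1..7. e i p [u] * e i p [v])"

definition flat :: "(nat \<Rightarrow> 'v form) \<Rightarrow> 'v \<Rightarrow> 'v form" where
  "flat e v p ws = (case ws of [w] \<Rightarrow> metric e p v w | _ \<Rightarrow> 0)"

text \<open>
  \<open>(*\<omega>)(v\<^sub>1, \<dots>, v\<^sub>m) vol = \<omega> \<and> v\<^sub>1\<^sup>\<flat> \<and> \<dots> \<and> v\<^sub>m\<^sup>\<flat>\<close>, where \<open>vol = e\<^sup>1 \<and> \<dots> \<and> e\<^sup>7\<close>; equivalently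
  \<open>\<alpha> \<and> *\<omega> = g(\<alpha>, \<omega>) vol\<close>.
\<close>

definition hodge :: "(nat \<Rightarrow> 'v form) \<Rightarrow> 'v form \<Rightarrow> 'v form" where
  "hodge e \<omega> p vs = frame_comp e (\<omega> \<and>\<^sub>f wedge_list (map (flat e) vs)) [1, 2, 3, 4, 5, 6, 7] p"

definition lie_bracket :: "('v::real_normed_vector \<Rightarrow> 'v) \<Rightarrow> ('v \<Rightarrow> 'v) \<Rightarrow> 'v \<Rightarrow> 'v" where
  "lie_bracket X Y p = frechet_derivative Y (at p) (X p) - frechet_derivative X (at p) (Y p)"

text \<open>
  A linear connection is given by its connection forms \<open>\<sigma> i j\<close> (upper index first),
  \<open>\<nabla>\<^sub>X E\<^sub>j = \<Sum>\<^sub>i \<sigma>\<^sup>i\<^sub>j(X) E\<^sub>i\<close>.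
\<close>

type_synonym 'v connection = "nat \<Rightarrow> nat \<Rightarrow> 'v form"

definition connection_forms :: "'v::real_vector connection \<Rightarrow> bool" where
  "connection_forms \<sigma> \<longleftrightarrow> (\<forall>i j. one_form (\<sigma> i j) \<and> (i \<notin> {1..7} \<or> j \<notin> {1..7} \<longrightarrow> \<sigma> i j = 0))"

definition nabla_frame ::
    "(nat \<Rightarrow> 'v::real_vector form) \<Rightarrow> 'v connection \<Rightarrow> nat \<Rightarrow> nat \<Rightarrow> 'v \<Rightarrow> 'v" where
  "nabla_frame e \<sigma> i j p = (\<Sum>k=1..7. \<sigma> k j p [frame e i p] *\<^sub>R frame e k p)"

text \<open>
  Metric and torsion-free. Both conditions are tensorial, so they are imposed on the frame; in an
  orthonormal frame \<open>\<nabla>g = 0\<close> reads \<open>\<sigma>\<^sup>i\<^sub>j = - \<sigma>\<^sup>j\<^sub>i\<close>.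
\<close>

definition levi_civita :: "(nat \<Rightarrow> 'v::real_normed_vector form) \<Rightarrow> 'v connection" where
  "levi_civita e = (THE \<sigma>. connection_forms \<sigma> \<and> (\<forall>i j. \<sigma> i j = - \<sigma> j i) \<and>
     (\<forall>i\<in>{1..7}. \<forall>j\<in>{1..7}. \<forall>p.
        nabla_frame e \<sigma> i j p - nabla_frame e \<sigma> j i p
        = lie_bracket (frame e i) (frame e j) p))"

text \<open>\<open>g(\<nabla>\<^sup>+\<^sub>X E\<^sub>j, E\<^sub>i) = g(\<nabla>\<^sub>X E\<^sub>j, E\<^sub>i) + 1/2 T(X, E\<^sub>j, E\<^sub>i)\<close> for a 3-form \<open>T\<close>; \<open>vs = [X]\<close>.\<close>

definition add_torsion ::
    "(nat \<Rightarrow> 'v form) \<Rightarrow> 'v connection \<Rightarrow> 'v form \<Rightarrow> 'v connection" where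
  "add_torsion e \<sigma> T i j p vs = \<sigma> i j p vs +
     (if i \<in> {1..7} \<and> j \<in> {1..7} then 1/2 * T p (vs @ [frame e j p, frame e i p]) else 0)"

definition curvature :: "'v::real_normed_vector connection \<Rightarrow> nat \<Rightarrow> nat \<Rightarrow> 'v form" where
  "curvature \<sigma> i j = ext_d (\<sigma> i j) + (\<Sum>k=1..7. \<sigma> i k \<and>\<^sub>f \<sigma> k j)"

definition pontryagin1 :: "'v::real_normed_vector connection \<Rightarrow> 'v form" where
  "pontryagin1 \<sigma> = smult_form (1 / (8 * pi\<^sup>2))
     (\<Sum>i=1..7. \<Sum>j\<in>{i<..7}. curvature \<sigma> i j \<and>\<^sub>f curvature \<sigma> i j)"

text \<open>\<open>R\<^sub>i\<^sub>j\<^sub>k\<^sub>l = g(R(E\<^sub>i, E\<^sub>j) E\<^sub>k, E\<^sub>l) = \<Omega>\<^sup>l\<^sub>k(E\<^sub>i, E\<^sub>j)\<close>\<close>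

definition curv_comp ::
    "(nat \<Rightarrow> 'v::real_normed_vector form) \<Rightarrow> 'v connection \<Rightarrow> nat \<Rightarrow> nat \<Rightarrow> nat \<Rightarrow> nat \<Rightarrow> 'v \<Rightarrow> real"
  where "curv_comp e \<sigma> i j k l p = frame_comp e (curvature \<sigma> l k) [i, j] p"

text \<open>\<open>Ric(Y, Z) = tr (X \<mapsto> R(X, Y) Z)\<close>\<close>

definition ricci ::
    "(nat \<Rightarrow> 'v::real_normed_vector form) \<Rightarrow> 'v connection \<Rightarrow> nat \<Rightarrow> nat \<Rightarrow> 'v \<Rightarrow> real" where
  "ricci e \<sigma> i j p = (\<Sum>k=1..7. curv_comp e \<sigma> k i j k p)"

text \<open>\<open>(\<nabla>\<^sub>E\<^sub>m \<omega>)(E\<^sub>i\<^sub>1, \<dots>, E\<^sub>i\<^sub>k)\<close>\<close>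

definition nabla_form ::
    "(nat \<Rightarrow> 'v::real_normed_vector form) \<Rightarrow> 'v connection \<Rightarrow> 'v form \<Rightarrow> nat \<Rightarrow> nat list \<Rightarrow> 'v \<Rightarrow> real"
  where "nabla_form e \<sigma> \<omega> m is p =
    frechet_derivative (frame_comp e \<omega> is) (at p) (frame e m p)
    - (\<Sum>r<length is. \<Sum>l=1..7. \<sigma> l (is ! r) p [frame e m p] * frame_comp e \<omega> (is[r := l]) p)"


section \<open>Heterotic equations in dimension 7\<close>

definition cocalibrated_pure_type ::
    "(nat \<Rightarrow> 'v::real_normed_vector form) \<Rightarrow> 'v form \<Rightarrow> bool" where
  "cocalibrated_pure_type e \<Theta> \<longleftrightarrow> ext_d (hodge e \<Theta>) = 0 \<and> ext_d \<Theta> \<and>\<^sub>f \<Theta> = 0"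

definition G2_instanton ::
    "(nat \<Rightarrow> 'v::real_normed_vector form) \<Rightarrow> 'v form \<Rightarrow> 'v connection \<Rightarrow> bool" where
  "G2_instanton e \<Theta> A \<longleftrightarrow> (\<forall>i\<in>{1..7}. \<forall>j\<in>{1..7}. curvature A i j \<and>\<^sub>f hodge e \<Theta> = 0)"

text \<open>
  A real 8-dimensional module of the Clifford algebra with \<open>v\<cdot>v = -|v|\<^sup>2\<close>, with an invariant inner
  product. There are two such modules up to isomorphism, exchanged by \<open>\<gamma> \<mapsto> -\<gamma>\<close>; the normalisation
  of \<open>\<Theta>\<close> in \<open>killing_spinor_eqs\<close> selects one of them.
\<close>

definition clifford_module :: "(nat \<Rightarrow> real^8^8) \<Rightarrow> bool" where
  "clifford_module \<gamma> \<longleftrightarrow>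
     (\<forall>i\<in>{1..7}. transpose (\<gamma> i) = - \<gamma> i) \<and>
     (\<forall>i\<in>{1..7}. \<forall>j\<in>{1..7}. \<gamma> i ** \<gamma> j + \<gamma> j ** \<gamma> i = (if i = j then - mat 2 else 0))"

text \<open>\<open>subseqs [1, \<dots>, 7]\<close> enumerates the increasing multi-indices.\<close>

definition clifford_act ::
    "(nat \<Rightarrow> real^8^8) \<Rightarrow> (nat \<Rightarrow> 'v form) \<Rightarrow> 'v form \<Rightarrow> 'v \<Rightarrow> real^8 \<Rightarrow> real^8" where
  "clifford_act \<gamma> e \<omega> p s =
     (\<Sum>is\<leftarrow>subseqs [1, 2, 3, 4, 5, 6, 7].
        frame_comp e \<omega> is p *\<^sub>R foldr (\<lambda>i t. \<gamma> i *v t) is s)"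

text \<open>
  Spin lift of a metric connection. For \<open>\<gamma>\<^sub>i\<gamma>\<^sub>j + \<gamma>\<^sub>j\<gamma>\<^sub>i = -2\<delta>\<^sub>i\<^sub>j\<close> the factor \<open>-1/4\<close> is the one that
  makes Clifford multiplication parallel.
\<close>

definition spin_nabla ::
    "(nat \<Rightarrow> real^8^8) \<Rightarrow> 'v::real_normed_vector connection \<Rightarrow> ('v \<Rightarrow> real^8) \<Rightarrow> 'v \<Rightarrow> 'v \<Rightarrow> real^8"
  where "spin_nabla \<gamma> \<sigma> \<epsilon> p v = frechet_derivative \<epsilon> (at p) v
    - (1/4) *\<^sub>R (\<Sum>i=1..7. \<Sum>j=1..7. \<sigma> i j p [v] *\<^sub>R (\<gamma> i *v (\<gamma> j *v \<epsilon> p)))"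

text \<open>
  Killing spinor equations on the quotient by \<open>heis_lattice\<close>, with spinors written in the
  trivialisation induced by the (left-invariant) frame. The spinor \<open>\<epsilon>\<close> is the unit spinor defining
  \<open>\<Theta>\<close>: \<open>\<Theta>(X, Y, Z) = \<langle>X\<cdot>Y\<cdot>Z\<cdot>\<epsilon>, \<epsilon>\<rangle>\<close>.
\<close>

definition killing_spinor_eqs ::
    "(nat \<Rightarrow> chart form) \<Rightarrow> chart form \<Rightarrow> chart connection \<Rightarrow> chart form \<Rightarrow> (chart \<Rightarrow> real)
      \<Rightarrow> chart connection \<Rightarrow> bool" where
  "killing_spinor_eqs e \<Theta> \<sigma> H \<phi> A \<longleftrightarrow>
     (\<exists>\<gamma> \<epsilon>. clifford_module \<gamma> \<and>
        (\<forall>p. \<epsilon> differentiable at p) \<and>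
        (\<forall>M\<in>heis_lattice. \<forall>p. \<epsilon> (left_trans M p) = \<epsilon> p) \<and>
        (\<forall>p. \<epsilon> p \<noteq> 0) \<and>
        (\<forall>p. \<forall>i\<in>{1..7}. \<forall>j\<in>{1..7}. \<forall>k\<in>{1..7}.
           frame_comp e \<Theta> [i, j, k] p = (\<gamma> i *v (\<gamma> j *v (\<gamma> k *v \<epsilon> p))) \<bullet> \<epsilon> p) \<and>
        (\<forall>p v. spin_nabla \<gamma> \<sigma> \<epsilon> p v = 0) \<and>
        (\<forall>p. clifford_act \<gamma> e (ext_d (fn_form \<phi>) - smult_form (1/2) H) p (\<epsilon> p) = 0) \<and>
        (\<forall>p. \<forall>i\<in>{1..7}. \<forall>j\<in>{1..7}. clifford_act \<gamma> e (curvature A i j) p (\<epsilon> p) = 0))"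

definition anomaly_cancellation ::
    "real \<Rightarrow> chart form \<Rightarrow> chart connection \<Rightarrow> chart connection \<Rightarrow> bool" where
  "anomaly_cancellation \<alpha>' T \<sigma> A \<longleftrightarrow>
     ext_d T = smult_form (2 * pi\<^sup>2 * \<alpha>') (pontryagin1 \<sigma> - pontryagin1 A)"

text \<open>
  Equations of motion with constant dilaton; \<open>\<sigma>\<close> is \<open>\<nabla>\<^sup>+\<close>. The skew pair of bundle indices in the
  quadratic curvature terms is summed over \<open>k < l\<close>, as in \<open>pontryagin1\<close>. This common normalisation
  of the trace is what allows the anomaly condition and the Einstein equation to hold with the same
  \<open>\<alpha>'\<close>. Summing over all ordered pairs would double the bracket; on \<open>N(3,1)\<close> the \<open>(1,1)\<close> component of
  the left-hand side would then be \<open>a\<^sup>2\<close>. All other sums are over all values.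
\<close>

definition einstein_eq ::
    "real \<Rightarrow> (nat \<Rightarrow> chart form) \<Rightarrow> chart form \<Rightarrow> chart connection \<Rightarrow> chart connection \<Rightarrow> bool" where
  "einstein_eq \<alpha>' e H \<sigma> A \<longleftrightarrow> (\<forall>p. \<forall>i\<in>{1..7}. \<forall>j\<in>{1..7}.
     ricci e (levi_civita e) i j p
     - 1/4 * (\<Sum>m=1..7. \<Sum>n=1..7. frame_comp e H [i, m, n] p * frame_comp e H [j, m, n] p)
     - \<alpha>'/4 *
        ((\<Sum>m=1..7. \<Sum>k=1..7. \<Sum>l\<in>{k<..7}. curv_comp e A i m k l p * curv_comp e A j m k l p)
       - (\<Sum>m=1..7. \<Sum>k=1..7. \<Sum>l\<in>{k<..7}. curv_comp e \<sigma> i m k l p * curv_comp e \<sigma> j m k l p))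
     = 0)"

definition flux_eq :: "(nat \<Rightarrow> chart form) \<Rightarrow> chart form \<Rightarrow> bool" where
  "flux_eq e H \<longleftrightarrow> (\<forall>p. \<forall>j\<in>{1..7}. \<forall>k\<in>{1..7}.
     (\<Sum>i=1..7. nabla_form e (levi_civita e) H i [i, j, k] p) = 0)"

text \<open>\<open>(\<nabla>\<^sub>i F)\<^sup>a\<^sub>b\<close> is coupled to \<open>A\<close> through the commutator \<open>[A(E\<^sub>i), F]\<^sup>a\<^sub>b\<close>.\<close>

definition gauge_eq ::
    "(nat \<Rightarrow> chart form) \<Rightarrow> chart connection \<Rightarrow> chart connection \<Rightarrow> bool" where
  "gauge_eq e \<sigma> A \<longleftrightarrow> (\<forall>p. \<forall>j\<in>{1..7}. \<forall>a\<in>{1..7}. \<forall>b\<in>{1..7}.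
     (\<Sum>i=1..7. nabla_form e \<sigma> (curvature A a b) i [i, j] p
        + (\<Sum>k=1..7. A a k p [frame e i p] * frame_comp e (curvature A k b) [i, j] p
                    - frame_comp e (curvature A a k) [i, j] p * A k b p [frame e i p])) = 0)"

definition heterotic_eom ::
    "real \<Rightarrow> (nat \<Rightarrow> chart form) \<Rightarrow> chart form \<Rightarrow> chart connection \<Rightarrow> chart connection \<Rightarrow> bool" where
  "heterotic_eom \<alpha>' e H \<sigma> A \<longleftrightarrow> einstein_eq \<alpha>' e H \<sigma> A \<and> flux_eq e H \<and> gauge_eq e \<sigma> A"


section \<open>The data on \<open>N(3,1)\<close>\<close>

text \<open>
  Tensor fields and connections on \<open>N(3,1) = \<Gamma>(3,1)\<setminus>H(3,1)\<close> are those on \<open>H(3,1)\<close> invariant under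
  the left translations by \<open>\<Gamma>(3,1)\<close>. Since the coframe is left-invariant, a connection is invariant
  iff its connection forms are.
\<close>

definition dx :: "3 \<Rightarrow> chart form" where
  "dx i = ext_d (fn_form (\<lambda>(x, y, z). x $ i))"

definition dy :: "3 \<Rightarrow> chart form" where
  "dy i = ext_d (fn_form (\<lambda>(x, y, z). y $ i))"

definition dz :: "chart form" where
  "dz = ext_d (fn_form (\<lambda>(x, y, z). z))"

definition contact_form :: "chart form" where
  "contact_form = (\<Sum>i\<in>UNIV. fmult (\<lambda>(x, y, z). x $ i) (dy i)) - dz"

definition heis_coframe :: "real \<Rightarrow> real \<Rightarrow> real \<Rightarrow> nat \<Rightarrow> chart form" where
  "heis_coframe a b c i =
     (if i = 1 then smult_form (1/a) (dx 1)
      else if i = 2 then dy 1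
      else if i = 3 then smult_form (1/b) (dx 2)
      else if i = 4 then dy 2
      else if i = 5 then smult_form (1/c) (dx 3)
      else if i = 6 then dy 3
      else if i = 7 then contact_form
      else 0)"

definition G2_form :: "(nat \<Rightarrow> 'v form) \<Rightarrow> 'v form" where
  "G2_form e =
     (coframe_prod e [1, 2] + coframe_prod e [3, 4] + coframe_prod e [5, 6]) \<and>\<^sub>f e 7
     + coframe_prod e [1, 3, 5] - coframe_prod e [1, 4, 6]
     - coframe_prod e [2, 3, 6] - coframe_prod e [2, 4, 5]"

definition heis_connection :: "(nat \<Rightarrow> 'v form) \<Rightarrow> real \<Rightarrow> real \<Rightarrow> real \<Rightarrow> 'v connection" where
  "heis_connection e lam mu tau i j =
     (if (i, j) = (1, 2) then smult_form lam (e 7)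
      else if (i, j) = (2, 1) then - smult_form lam (e 7)
      else if (i, j) = (3, 4) then smult_form mu (e 7)
      else if (i, j) = (4, 3) then - smult_form mu (e 7)
      else if (i, j) = (5, 6) then smult_form tau (e 7)
      else if (i, j) = (6, 5) then - smult_form tau (e 7)
      else 0)"

definition sym_square :: "'v form \<Rightarrow> 'v \<Rightarrow> 'v \<Rightarrow> 'v \<Rightarrow> real" where
  "sym_square \<omega> p u v = \<omega> p [u] * \<omega> p [v]"

end

theory Submission
  imports Defs
begin

text \<open>
  The wedge product obeys \<open>\<iota>\<^sub>v(\<omega> \<and> \<eta>) = \<iota>\<^sub>v\<omega> \<and> \<eta> + (-1)\<^bsup>deg \<omega>\<^esup> \<omega> \<and> \<iota>\<^sub>v\<eta>\<close>; associativity and the Leibniz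
  rule follow from this and \<open>\<iota>\<^sub>v d = D\<^sub>v - d \<iota>\<^sub>v\<close> (for constant \<open>v\<close>) by induction on the number of
  arguments. Put \<open>w = de\<^sup>7\<close>. Then \<open>T = w \<and> e\<^sup>7\<close>, and Koszul's formula gives
  \<open>(\<sigma>\<^sup>+)\<^sup>i\<^sub>j = w\<^sub>j\<^sub>i e\<^sup>7\<close>, so that \<open>\<nabla>\<^sup>+\<close> is itself the connection \<open>A\<close> with parameters
  \<open>(-a, -b, a + b)\<close>. A connection of this family has curvature proportional to \<open>w\<close>, and its first
  Pontryagin form is \<open>(\<lambda>\<^sup>2 + \<mu>\<^sup>2 + \<tau>\<^sup>2) / 8\<pi>\<^sup>2\<close> times \<open>w \<and> w = dT\<close>. Because \<open>a + b + c = 0\<close>, the form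
  \<open>w\<close> satisfies \<open>w \<and> *\<Theta> = 0\<close> and annihilates the constant spinor. In the Einstein equation all terms
  reduce to multiples of \<open>W\<^sub>i\<^sub>j = \<Sum>\<^sub>m w\<^sub>i\<^sub>m w\<^sub>j\<^sub>m\<close> and of \<open>e\<^sup>7 \<otimes> e\<^sup>7\<close>.
\<close>

section \<open>The algebra of forms\<close>

text \<open>The type \<open>form\<close> imposes neither alternation nor linearity nor a degree, so
  every identity for the wedge is proved for arbitrary functions on lists. The shuffle sum is
  awkward for this; the recursion on the first argument turns each identity into a short induction,
  with (-1)^deg replaced by the operator \<open>grade\<close>. Two definitions by description shape
  the rest: \<open>frame\<close> is accessible only through unique existence of dual vectors, and
  \<open>levi_civita\<close> requires both a solution and its uniqueness. The geometry uses only the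
  structure equations and a + b + c = 0, hence a locale. Origin of \<alpha>': since a^2 + b^2 + c^2
  = 2(a^2 + ab + b^2), the difference of Pontryagin forms is D/(8 pi^2) times the square of w, where
  D is the denominator of \<alpha>'; the factor 2 pi^2 then requires 4/D. The same value balances
  the Einstein equation: Ricci and flux terms add up to -W, the curvature bracket gives W. The
  spinor is the unit octonion, acted on by left multiplication: the planes 12, 34, 56 act on it
  identically, so only a + b + c enters.\<close>

primrec wedge_at :: "'v list \<Rightarrow> ('v list \<Rightarrow> real) \<Rightarrow> ('v list \<Rightarrow> real) \<Rightarrow> real" where
  "wedge_at [] f g = f [] * g []"
| "wedge_at (v # vs) f g = wedge_at vs (\<lambda>ws. f (v # ws)) g
     + wedge_at vs (\<lambda>ws. (-1) ^ length ws * f ws) (\<lambda>ws. g (v # ws))"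

text \<open>The two sums correspond to the first argument going to the left or to the right factor
  of a wedge.\<close>

lemma sum_Pow_lessThan_Suc:
  fixes F :: "nat set \<Rightarrow> real"
  shows "(\<Sum>A\<in>Pow {..<Suc n}. F A)
    = (\<Sum>B\<in>Pow {..<n}. F (insert 0 (Suc ` B))) + (\<Sum>B\<in>Pow {..<n}. F (Suc ` B))"
proof -
  have split: "Pow {..<Suc n} = (\<lambda>B. insert 0 (Suc ` B)) ` Pow {..<n} \<union> (\<lambda>B. Suc ` B) ` Pow {..<n}"
    by (simp add: lessThan_Suc_eq_insert_0 Pow_insert image_Pow_surj Un_commute image_image
        flip: image_Pow_surj)
  have disj: "(\<lambda>B. insert 0 (Suc ` B)) ` Pow {..<n} \<inter> (\<lambda>B. Suc ` B) ` Pow {..<n} = {}"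
    by auto
  have inj1: "inj_on (\<lambda>B. insert 0 (Suc ` B)) (Pow {..<n})"
  proof (rule inj_onI)
    fix x y :: "nat set" assume "insert 0 (Suc ` x) = insert 0 (Suc ` y)"
    then have "insert 0 (Suc ` x) - {0} = insert 0 (Suc ` y) - {0}" by simp
    moreover have "insert 0 (Suc ` x) - {0} = Suc ` x" for x by auto
    ultimately show "x = y" by (simp add: inj_image_eq_iff)
  qed
  have inj2: "inj_on (\<lambda>B. Suc ` B) (Pow {..<n})"
    by (rule inj_onI) (simp add: inj_image_eq_iff)
  show ?thesis
    unfolding split by (subst sum.union_disjoint)
      (use disj in \<open>simp_all add: sum.reindex[OF inj1] sum.reindex[OF inj2]\<close>)
qed

text \<open>First argument in the left factor: no position is smaller than 0, so it takes part in no
  inversion.\<close>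

lemma card_inversions_insert_0:
  "card {(i, j). i \<in> insert 0 (Suc ` B) \<and> j \<in> {..<Suc n} - insert 0 (Suc ` B) \<and> j < i}
    = card {(i, j). i \<in> B \<and> j \<in> {..<n} - B \<and> j < i}"
proof -
  have "{(i, j). i \<in> insert 0 (Suc ` B) \<and> j \<in> {..<Suc n} - insert 0 (Suc ` B) \<and> j < i}
      = map_prod Suc Suc ` {(i, j). i \<in> B \<and> j \<in> {..<n} - B \<and> j < i}" (is "?L = ?R")
  proof (intro subset_antisym subsetI)
    fix z assume "z \<in> ?L"
    then obtain i j where z: "z = (i, j)" "i \<in> insert 0 (Suc ` B)" "j < Suc n"
      "j \<notin> insert 0 (Suc ` B)" "j < i" by blast
    then obtain i' j' where ij: "i = Suc i'" "j = Suc j'" by (metis insertI1 insertE imageE not_less_zero nat.exhaust)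
    with z have "i' \<in> B" "j' < n" "j' \<notin> B" "j' < i'" by (simp_all add: inj_image_mem_iff)
    then show "z \<in> ?R" unfolding z(1) ij by (intro image_eqI[of _ _ "(i', j')"]) simp_all
  next
    fix z assume "z \<in> ?R"
    then obtain i j where "z = (Suc i, Suc j)" "i \<in> B" "j < n" "j \<notin> B" "j < i"
      by (elim imageE) (simp split: prod.splits)
    then show "z \<in> ?L" by (simp add: inj_image_mem_iff)
  qed
  then show ?thesis
    by (simp add: card_image inj_on_def)
qed

text \<open>First argument in the right factor: position 0 is inverted with every element of the
  left one. The extra \<open>card B\<close> is the exponent of the sign in
  \<open>wedge_at\<close>.\<close>

lemma card_inversions_Suc:
  assumes "B \<subseteq> {..<n}"
  shows "card {(i, j). i \<in> Suc ` B \<and> j \<in> {..<Suc n} - Suc ` B \<and> j < i}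
    = card {(i, j). i \<in> B \<and> j \<in> {..<n} - B \<and> j < i} + card B"
proof -
  have fB: "finite B" using assms finite_subset by blast
  have fin: "finite {(i, j). i \<in> B \<and> j \<in> {..<n} - B \<and> j < i}"
    by (rule finite_subset[of _ "B \<times> {..<n}"]) (use fB in auto)
  have eq: "{(i, j). i \<in> Suc ` B \<and> j \<in> {..<Suc n} - Suc ` B \<and> j < i}
      = map_prod Suc Suc ` {(i, j). i \<in> B \<and> j \<in> {..<n} - B \<and> j < i} \<union> (\<lambda>i. (Suc i, 0)) ` B"
    (is "?L = ?R")
  proof (intro subset_antisym subsetI)
    fix z assume "z \<in> ?L"
    then obtain i j where z: "z = (Suc i, j)" "i \<in> B" "j < Suc n"
      "j \<notin> Suc ` B" "j < Suc i" by blast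
    show "z \<in> ?R"
    proof (cases j)
      case 0
      with z show ?thesis by blast
    next
      case (Suc j')
      with z have "j' < n" "j' \<notin> B" "j' < i" by auto
      then have "(Suc i, Suc j') \<in> map_prod Suc Suc ` {(i, j). i \<in> B \<and> j \<in> {..<n} - B \<and> j < i}"
        using z(2) by (intro image_eqI[of _ _ "(i, j')"]) simp_all
      then show ?thesis unfolding z(1) Suc by (rule UnI1)
    qed
  next
    fix z assume "z \<in> ?R"
    then consider i j where "z = (Suc i, Suc j)" "i \<in> B" "j < n" "j \<notin> B" "j < i"
      | i where "z = (Suc i, 0)" "i \<in> B"
      by (elim UnE imageE) (simp_all split: prod.splits)
    then show "z \<in> ?L" by cases auto
  qed
  have "card (map_prod Suc Suc ` {(i, j). i \<in> B \<and> j \<in> {..<n} - B \<and> j < i} \<union> (\<lambda>i. (Suc i, 0)) ` B)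
      = card (map_prod Suc Suc ` {(i, j). i \<in> B \<and> j \<in> {..<n} - B \<and> j < i})
      + card ((\<lambda>i. (Suc i, 0::nat)) ` B)"
    by (rule card_Un_disjoint) (use fin fB in auto)
  moreover have "card (map_prod Suc Suc ` {(i, j). i \<in> B \<and> j \<in> {..<n} - B \<and> j < i})
      = card {(i, j). i \<in> B \<and> j \<in> {..<n} - B \<and> j < i}"
    by (rule card_image) (simp add: inj_on_def)
  moreover have "card ((\<lambda>i. (Suc i, 0::nat)) ` B) = card B"
    by (rule card_image) (simp add: inj_on_def)
  ultimately show ?thesis unfolding eq by (simp only:)

qed

lemma wedge_at_shuffle:
  "wedge_at vs f g = (\<Sum>A\<in>Pow {..<length vs}.
        (-1) ^ card {(i, j). i \<in> A \<and> j \<in> {..<length vs} - A \<and> j < i}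
        * f (nths vs A) * g (nths vs (- A)))"
proof (induction vs arbitrary: f g)
  case (Cons v vs)
  have nths_insert: "nths (v # vs) (insert 0 (Suc ` B)) = v # nths vs B"
    "nths (v # vs) (- insert 0 (Suc ` B)) = nths vs (- B)"
    "nths (v # vs) (Suc ` B) = nths vs B"
    "nths (v # vs) (- (Suc ` B)) = v # nths vs (- B)" for B
    by (auto simp: nths_Cons image_iff intro!: arg_cong2[where f = nths])
  have len: "length (nths vs B) = card B" if "B \<subseteq> {..<length vs}" for B
    using that by (auto simp: length_nths intro!: arg_cong[where f = card])
  have sgn: "(-1) ^ card {(i, j). i \<in> B \<and> j \<in> {..<length vs} - B \<and> j < i}
        * ((-1) ^ length (nths vs B) * f (nths vs B)) * h
      = (-1) ^ card {(i, j). i \<in> Suc ` B \<and> j \<in> {..<Suc (length vs)} - Suc ` B \<and> j < i}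
        * f (nths vs B) * h" if "B \<in> Pow {..<length vs}" for B and h :: real
    using that unfolding Pow_iff
    by (subst card_inversions_Suc) (simp_all only: len power_add mult.assoc)
  show ?case
    unfolding length_Cons sum_Pow_lessThan_Suc nths_insert card_inversions_insert_0
      wedge_at.simps Cons.IH
    by (intro arg_cong2[where f = "(+)"] sum.cong refl sgn)
qed simp

lemma wedge_eq: "(\<omega> \<and>\<^sub>f \<eta>) p vs = wedge_at vs (\<omega> p) (\<eta> p)"
  by (simp add: wedge_def wedge_at_shuffle)

lemma wedge_at_add_left: "wedge_at vs (\<lambda>ws. f ws + g ws) h = wedge_at vs f h + wedge_at vs g h"
  by (induction vs arbitrary: f g h) (simp_all add: algebra_simps)

lemma wedge_at_add_right: "wedge_at vs h (\<lambda>ws. f ws + g ws) = wedge_at vs h f + wedge_at vs h g"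
  by (induction vs arbitrary: f g h) (simp_all add: algebra_simps)

lemma wedge_at_mult_left: "wedge_at vs (\<lambda>ws. r * f ws) h = r * wedge_at vs f h"
proof (induction vs arbitrary: f h)
  case (Cons v vs)
  then show ?case by (simp add: distrib_left mult.left_commute[of _ r])
qed simp

lemma wedge_at_mult_right: "wedge_at vs h (\<lambda>ws. r * f ws) = r * wedge_at vs h f"
  by (induction vs arbitrary: f h) (simp_all add: algebra_simps)

lemma wedge_at_zero_left: "wedge_at vs (\<lambda>ws. 0) h = 0"
  using wedge_at_mult_left[of vs 0 "\<lambda>_. 0" h] by simp

lemma wedge_at_zero_right: "wedge_at vs h (\<lambda>ws. 0) = 0"
  using wedge_at_mult_right[of vs h 0 "\<lambda>_. 0"] by simp

lemma wedge_at_minus_left: "wedge_at vs (\<lambda>ws. - f ws) h = - wedge_at vs f h"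
  using wedge_at_mult_left[of vs "-1" f h] by simp

lemma wedge_at_minus_right: "wedge_at vs h (\<lambda>ws. - f ws) = - wedge_at vs h f"
  using wedge_at_mult_right[of vs h "-1" f] by simp

text \<open>A shuffle distributes all arguments, so the two lengths add up to
  \<open>length vs\<close> and the grading is multiplicative. The induction for associativity needs
  this in its second summand.\<close>

lemma wedge_at_sign:
  "(-1) ^ length vs * wedge_at vs f g
    = wedge_at vs (\<lambda>ws. (-1) ^ length ws * f ws) (\<lambda>ws. (-1) ^ length ws * g ws)"
proof (induction vs arbitrary: f g)
  case (Cons v vs)
  show ?case
    by (simp add: distrib_left mult.assoc Cons.IH wedge_at_minus_left wedge_at_minus_right)
qed simp

lemma wedge_at_assoc:
  "wedge_at vs (\<lambda>ws. wedge_at ws f g) h = wedge_at vs f (\<lambda>ws. wedge_at ws g h)"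
  by (induction vs arbitrary: f g h)
    (simp_all add: wedge_at_add_left wedge_at_add_right wedge_at_sign)

lemma wedge_at_map: "wedge_at (map L vs) f g = wedge_at vs (\<lambda>ws. f (map L ws)) (\<lambda>ws. g (map L ws))"
  by (induction vs arbitrary: f g) simp_all

lemma wedge_assoc: "(\<omega> \<and>\<^sub>f \<eta>) \<and>\<^sub>f \<zeta> = \<omega> \<and>\<^sub>f (\<eta> \<and>\<^sub>f \<zeta>)"
  by (intro ext) (simp add: wedge_eq wedge_eq[abs_def] wedge_at_assoc)

lemma wedge_add_left: "(\<omega> + \<eta>) \<and>\<^sub>f \<zeta> = \<omega> \<and>\<^sub>f \<zeta> + \<eta> \<and>\<^sub>f \<zeta>"
  by (intro ext) (simp add: wedge_eq wedge_at_add_left plus_fun_def)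

lemma wedge_add_right: "\<zeta> \<and>\<^sub>f (\<omega> + \<eta>) = \<zeta> \<and>\<^sub>f \<omega> + \<zeta> \<and>\<^sub>f \<eta>"
  by (intro ext) (simp add: wedge_eq wedge_at_add_right plus_fun_def)

lemma wedge_minus_left: "(- \<omega>) \<and>\<^sub>f \<zeta> = - (\<omega> \<and>\<^sub>f \<zeta>)"
  by (intro ext) (simp add: wedge_eq wedge_at_minus_left fun_Compl_def)

lemma wedge_minus_right: "\<zeta> \<and>\<^sub>f (- \<omega>) = - (\<zeta> \<and>\<^sub>f \<omega>)"
  by (intro ext) (simp add: wedge_eq wedge_at_minus_right fun_Compl_def)

lemma wedge_diff_left: "(\<omega> - \<eta>) \<and>\<^sub>f \<zeta> = \<omega> \<and>\<^sub>f \<zeta> - \<eta> \<and>\<^sub>f \<zeta>"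
  using wedge_add_left[of \<omega> "- \<eta>" \<zeta>] by (simp add: wedge_minus_left)

lemma wedge_diff_right: "\<zeta> \<and>\<^sub>f (\<omega> - \<eta>) = \<zeta> \<and>\<^sub>f \<omega> - \<zeta> \<and>\<^sub>f \<eta>"
  using wedge_add_right[of \<zeta> \<omega> "- \<eta>"] by (simp add: wedge_minus_right)

lemma wedge_zero_left: "0 \<and>\<^sub>f \<zeta> = 0"
  by (intro ext) (simp add: wedge_eq wedge_at_zero_left zero_fun_def)

lemma wedge_zero_right: "\<zeta> \<and>\<^sub>f 0 = 0"
  by (intro ext) (simp add: wedge_eq wedge_at_zero_right zero_fun_def)

lemma wedge_fmult_left: "fmult f \<omega> \<and>\<^sub>f \<zeta> = fmult f (\<omega> \<and>\<^sub>f \<zeta>)"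
  by (intro ext) (simp add: wedge_eq fmult_def fmult_def[abs_def] wedge_at_mult_left)

lemma wedge_fmult_right: "\<zeta> \<and>\<^sub>f fmult f \<omega> = fmult f (\<zeta> \<and>\<^sub>f \<omega>)"
  by (intro ext) (simp add: wedge_eq fmult_def fmult_def[abs_def] wedge_at_mult_right)

lemmas wedge_distribs = wedge_add_left wedge_add_right wedge_diff_left wedge_diff_right
  wedge_minus_left wedge_minus_right wedge_zero_left wedge_zero_right
  wedge_fmult_left wedge_fmult_right

lemma wedge_one_left: "fn_form (\<lambda>_. 1) \<and>\<^sub>f \<omega> = \<omega>"
proof (intro ext)
  fix p and vs :: "'a list"
  have "wedge_at vs (fn_form (\<lambda>_. 1) p) g = g vs" for g
    by (induction vs arbitrary: g) (simp_all add: fn_form_def wedge_at_zero_left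
        if_distrib[of "\<lambda>x. _ * x"] cong: if_cong, simp add: fn_form_def[abs_def] cong: if_cong)
  then show "(fn_form (\<lambda>_. 1) \<and>\<^sub>f \<omega>) p vs = \<omega> p vs" by (simp add: wedge_eq)
qed

lemma wedge_one_right: "\<omega> \<and>\<^sub>f fn_form (\<lambda>_. 1) = \<omega>"
proof (intro ext)
  fix p and vs :: "'a list"
  have "wedge_at vs g (fn_form (\<lambda>_. 1) p) = g vs" for g
    by (induction vs arbitrary: g) (simp_all add: fn_form_def wedge_at_zero_right)
  then show "(\<omega> \<and>\<^sub>f fn_form (\<lambda>_. 1)) p vs = \<omega> p vs" by (simp add: wedge_eq)
qed

lemma wedge_list_Nil: "wedge_list [] = fn_form (\<lambda>_. 1)"
  and wedge_list_Cons: "wedge_list (\<omega> # \<omega>s) = \<omega> \<and>\<^sub>f wedge_list \<omega>s"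
  by (simp_all add: wedge_list_def)

section \<open>Wedge products with factors of degree one\<close>

definition degree1 :: "('v list \<Rightarrow> real) \<Rightarrow> bool" where
  "degree1 f \<longleftrightarrow> (\<forall>vs. length vs \<noteq> 1 \<longrightarrow> f vs = 0)"

lemma wedge_at_const_left:
  assumes "\<And>ws. ws \<noteq> [] \<Longrightarrow> f ws = 0"
  shows "wedge_at vs f g = f [] * g vs"
  using assms
proof (induction vs arbitrary: f g)
  case (Cons v vs)
  have "(\<lambda>ws. f (v # ws)) = (\<lambda>_. 0)" using Cons.prems by auto
  moreover have "wedge_at vs (\<lambda>ws. (-1) ^ length ws * f ws) (\<lambda>ws. g (v # ws)) = f [] * g (v # vs)"
    by (subst Cons.IH) (use Cons.prems in auto)
  ultimately show ?case by (simp add: wedge_at_zero_left)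
qed simp

text \<open>For a factor of degree one the grading is negation and contraction leaves a scalar. This
  is one step of a Laplace expansion.\<close>

lemma wedge_at_degree1_Cons:
  assumes "degree1 f"
  shows "wedge_at (v # vs) f g = f [v] * g vs - wedge_at vs f (\<lambda>ws. g (v # ws))"
proof -
  have "(\<lambda>ws. (-1) ^ length ws * f ws) = (\<lambda>ws. - f ws)"
  proof
    fix ws show "(-1) ^ length ws * f ws = - f ws"
      using assms by (cases "length ws = 1") (auto simp: degree1_def)
  qed
  moreover have "wedge_at vs (\<lambda>ws. f (v # ws)) g = f [v] * g vs"
    by (rule wedge_at_const_left) (use assms in \<open>auto simp: degree1_def\<close>)
  ultimately show ?thesis by (simp add: wedge_at_minus_left)
qed

lemma one_form_degree1: "one_form \<omega> \<Longrightarrow> degree1 (\<omega> p)"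
  by (simp add: one_form_def degree1_def)

lemma wedge_at_degree1_anticomm:
  assumes "degree1 f" "degree1 g"
  shows "wedge_at vs f g = - wedge_at vs g f"
proof (cases vs)
  case Nil
  then show ?thesis using assms by (simp add: degree1_def)
next
  case (Cons v vs')
  \<comment> \<open>Contracting the second factor also leaves a scalar, so the wedge of f and g on
    \<open>v # vs'\<close> equals f[v] g(vs') - g[v] f(vs'), which is visibly antisymmetric.\<close>
  have f: "wedge_at ws f (\<lambda>ws. h (v # ws)) = h [v] * f ws" if "degree1 f" "degree1 h"
    for f h :: "'a list \<Rightarrow> real" and ws
  proof (cases ws)
    case Nil then show ?thesis using that by (simp add: degree1_def)
  next
    case (Cons u us)
    have "(\<lambda>ws. h (v # u # ws)) = (\<lambda>_. 0)" using that by (auto simp: degree1_def)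
    then show ?thesis unfolding Cons wedge_at_degree1_Cons[OF that(1)]
      using that by (cases us) (auto simp: degree1_def wedge_at_zero_right)
  qed
  show ?thesis unfolding Cons wedge_at_degree1_Cons[OF assms(1)] wedge_at_degree1_Cons[OF assms(2)]
    by (simp add: f assms)
qed

lemma wedge_anticomm:
  assumes "one_form \<alpha>" "one_form \<beta>" shows "\<alpha> \<and>\<^sub>f \<beta> = - (\<beta> \<and>\<^sub>f \<alpha>)"
  using wedge_at_degree1_anticomm[OF assms[THEN one_form_degree1]]
  by (intro ext) (simp add: wedge_eq)

lemma wedge_self:
  assumes "one_form \<alpha>" shows "\<alpha> \<and>\<^sub>f \<alpha> = 0"
proof (intro ext)
  fix p vs show "(\<alpha> \<and>\<^sub>f \<alpha>) p vs = 0 p vs"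
    using fun_cong[OF fun_cong[OF wedge_anticomm[OF assms assms]], of p vs] by simp
qed

lemma wedge_anticomm_left:
  assumes "one_form \<alpha>" "one_form \<beta>" shows "\<alpha> \<and>\<^sub>f \<beta> \<and>\<^sub>f \<eta> = - (\<beta> \<and>\<^sub>f \<alpha> \<and>\<^sub>f \<eta>)"
  by (metis wedge_anticomm[OF assms] wedge_assoc wedge_minus_left)

lemma wedge_self_left:
  assumes "one_form \<alpha>" shows "\<alpha> \<and>\<^sub>f \<alpha> \<and>\<^sub>f \<eta> = 0"
  by (metis wedge_self[OF assms] wedge_assoc wedge_zero_left)

lemma pullback_wedge: "pullback f (\<omega> \<and>\<^sub>f \<eta>) = pullback f \<omega> \<and>\<^sub>f pullback f \<eta>"
  by (intro ext) (simp add: pullback_def pullback_def[abs_def] wedge_eq wedge_at_map)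


section \<open>The exterior derivative\<close>

definition diff_form :: "'v::real_normed_vector form \<Rightarrow> bool" where
  "diff_form \<omega> \<longleftrightarrow> (\<forall>vs p. (\<lambda>q. \<omega> q vs) differentiable at p)"

definition dir_deriv :: "'v::real_normed_vector \<Rightarrow> 'v form \<Rightarrow> 'v form" where
  "dir_deriv v \<omega> p vs = frechet_derivative (\<lambda>q. \<omega> q vs) (at p) v"

definition contract :: "'v \<Rightarrow> 'v form \<Rightarrow> 'v form" where
  "contract v \<omega> p vs = \<omega> p (v # vs)"

text \<open>The sign (-1)^deg as an operator, so that the antiderivation rules can be stated for
  inhomogeneous forms.\<close>

definition grade :: "'v form \<Rightarrow> 'v form" where
  "grade \<omega> p vs = (-1) ^ length vs * \<omega> p vs"

lemma ext_d_Nil: "ext_d \<omega> p [] = 0"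
  by (simp add: ext_d_def)

lemma ext_d_Cons: "ext_d \<omega> p (v # vs) = dir_deriv v \<omega> p vs - ext_d (contract v \<omega>) p vs"
  unfolding ext_d_def length_Cons sum.lessThan_Suc_shift
  by (simp add: dir_deriv_def contract_def sum_negf)

lemma wedge_Nil: "(\<omega> \<and>\<^sub>f \<eta>) p [] = \<omega> p [] * \<eta> p []"
  by (simp add: wedge_eq)

lemma contract_wedge:
  "contract v (\<omega> \<and>\<^sub>f \<eta>) = contract v \<omega> \<and>\<^sub>f \<eta> + grade \<omega> \<and>\<^sub>f contract v \<eta>"
  by (intro ext) (simp add: contract_def grade_def contract_def[abs_def] grade_def[abs_def] wedge_eq)

lemma wedge_Cons:
  "(\<omega> \<and>\<^sub>f \<eta>) p (v # vs) = (contract v \<omega> \<and>\<^sub>f \<eta>) p vs + (grade \<omega> \<and>\<^sub>f contract v \<eta>) p vs"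
  using fun_cong[OF fun_cong[OF contract_wedge]] by (simp add: contract_def)

lemma diff_form_contract: "diff_form \<omega> \<Longrightarrow> diff_form (contract v \<omega>)"
  by (simp add: diff_form_def contract_def)

lemma diff_form_grade: "diff_form \<omega> \<Longrightarrow> diff_form (grade \<omega>)"
  by (simp add: diff_form_def grade_def)

text \<open>Leibniz rule for the coefficients with the arguments held fixed. It starts from the
  product rule for real functions and propagates because directional derivatives commute with
  contraction and grading.\<close>

lemma has_derivative_wedge:
  assumes "diff_form \<omega>" "diff_form \<eta>"
  shows "((\<lambda>q. (\<omega> \<and>\<^sub>f \<eta>) q vs) has_derivative
    (\<lambda>v. (dir_deriv v \<omega> \<and>\<^sub>f \<eta>) p vs + (\<omega> \<and>\<^sub>f dir_deriv v \<eta>) p vs)) (at p)"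
  using assms
proof (induction vs arbitrary: \<omega> \<eta>)
  case Nil
  have "((\<lambda>q. \<omega> q []) has_derivative frechet_derivative (\<lambda>q. \<omega> q []) (at p)) (at p)"
    "((\<lambda>q. \<eta> q []) has_derivative frechet_derivative (\<lambda>q. \<eta> q []) (at p)) (at p)"
    using Nil by (auto simp: diff_form_def frechet_derivative_works)
  from has_derivative_mult[OF this] show ?case
    by (simp add: wedge_Nil dir_deriv_def add.commute)
next
  case (Cons u vs)
  have c: "dir_deriv v (contract u \<omega>) = contract u (dir_deriv v \<omega>)" for v and \<omega> :: "'a form"
    by (intro ext) (simp add: dir_deriv_def contract_def)
  have g: "dir_deriv v (grade \<omega>) = grade (dir_deriv v \<omega>)" for v
  proof (intro ext)
    fix p ws
    have "((\<lambda>q. \<omega> q ws) has_derivative frechet_derivative (\<lambda>q. \<omega> q ws) (at p)) (at p)"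
      using Cons.prems by (auto simp: diff_form_def frechet_derivative_works)
    from frechet_derivative_at[OF has_derivative_mult_right[OF this, of "(-1) ^ length ws"]]
    show "dir_deriv v (grade \<omega>) p ws = grade (dir_deriv v \<omega>) p ws"
      unfolding dir_deriv_def grade_def by (rule fun_cong[THEN sym])
  qed
  note d = Cons.prems Cons.prems[THEN diff_form_contract[of _ u]] Cons.prems[THEN diff_form_grade]
  show ?case unfolding wedge_Cons
    by (rule has_derivative_eq_rhs[OF has_derivative_add[OF Cons.IH[OF d(3,2)] Cons.IH[OF d(5,4)]]])
      (simp add: c g fun_eq_iff algebra_simps)
qed

lemma diff_form_wedge: "diff_form \<omega> \<Longrightarrow> diff_form \<eta> \<Longrightarrow> diff_form (\<omega> \<and>\<^sub>f \<eta>)"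
  unfolding diff_form_def[of "_ \<and>\<^sub>f _"] differentiable_def using has_derivative_wedge by blast

lemma dir_deriv_wedge:
  assumes "diff_form \<omega>" "diff_form \<eta>"
  shows "dir_deriv v (\<omega> \<and>\<^sub>f \<eta>) = dir_deriv v \<omega> \<and>\<^sub>f \<eta> + \<omega> \<and>\<^sub>f dir_deriv v \<eta>"
  by (intro ext) (simp add: dir_deriv_def frechet_derivative_at[OF has_derivative_wedge[OF assms], symmetric])

lemma has_derivative_diff_form: "diff_form \<omega> \<Longrightarrow>
   ((\<lambda>q. \<omega> q ws) has_derivative frechet_derivative (\<lambda>q. \<omega> q ws) (at p)) (at p)"
  by (auto simp: diff_form_def frechet_derivative_works)

lemma frechet_derivative_plus_form:
  assumes "diff_form \<omega>" "diff_form \<eta>"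
  shows "frechet_derivative (\<lambda>q. \<omega> q ws + \<eta> q ws) (at p) v
    = frechet_derivative (\<lambda>q. \<omega> q ws) (at p) v + frechet_derivative (\<lambda>q. \<eta> q ws) (at p) v"
  using frechet_derivative_at[OF has_derivative_add[OF assms[THEN has_derivative_diff_form, of ws p]]]
  by (metis (no_types))

lemma frechet_derivative_cmult_form:
  assumes "diff_form \<omega>"
  shows "frechet_derivative (\<lambda>q. r * \<omega> q ws) (at p) v = r * frechet_derivative (\<lambda>q. \<omega> q ws) (at p) v"
  using frechet_derivative_at[OF has_derivative_mult_right[OF assms[THEN has_derivative_diff_form, of ws p], of r]]
  by (metis (no_types))

lemma ext_d_add: "diff_form \<omega> \<Longrightarrow> diff_form \<eta> \<Longrightarrow> ext_d (\<omega> + \<eta>) = ext_d \<omega> + ext_d \<eta>"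
  by (intro ext) (simp add: ext_d_def frechet_derivative_plus_form sum.distrib algebra_simps)

lemma ext_d_smult: "diff_form \<omega> \<Longrightarrow> ext_d (smult_form r \<omega>) = smult_form r (ext_d \<omega>)"
  by (intro ext)
    (simp add: ext_d_def fmult_def frechet_derivative_cmult_form sum_distrib_left algebra_simps)

lemma ext_d_minus: "diff_form \<omega> \<Longrightarrow> ext_d (- \<omega>) = - ext_d \<omega>"
  by (intro ext)
   (use frechet_derivative_cmult_form[of \<omega> "-1"] in \<open>simp add: ext_d_def sum_negf\<close>)

lemma diff_form_add: "diff_form \<omega> \<Longrightarrow> diff_form \<eta> \<Longrightarrow> diff_form (\<omega> + \<eta>)"
  and diff_form_minus: "diff_form \<omega> \<Longrightarrow> diff_form (- \<omega>)"
  and diff_form_smult: "diff_form \<omega> \<Longrightarrow> diff_form (smult_form r \<omega>)"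
  and diff_form_zero: "diff_form 0"
  by (simp_all add: diff_form_def fmult_def)

lemma diff_form_diff: "diff_form \<omega> \<Longrightarrow> diff_form \<eta> \<Longrightarrow> diff_form (\<omega> - \<eta>)"
  using diff_form_add[of \<omega> "- \<eta>"] diff_form_minus[of \<eta>] by simp

lemma ext_d_diff: "diff_form \<omega> \<Longrightarrow> diff_form \<eta> \<Longrightarrow> ext_d (\<omega> - \<eta>) = ext_d \<omega> - ext_d \<eta>"
  using ext_d_add[of \<omega> "- \<eta>"] by (simp add: diff_form_minus ext_d_minus)

lemma frechet_derivative_zero: "frechet_derivative (\<lambda>q. 0::real) (at p) v = 0"
  by (metis frechet_derivative_const)

lemma ext_d_zero: "ext_d 0 = 0"
  by (intro ext) (simp add: ext_d_def frechet_derivative_zero)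

lemma ext_d_const: "ext_d (fn_form (\<lambda>_. r)) = 0"
proof (intro ext)
  fix p and vs :: "'a list"
  have "(\<lambda>q::'a. fn_form (\<lambda>_. r) q ws) = (\<lambda>_. if ws = [] then r else 0)" for ws
    by (simp add: fn_form_def)
  then show "ext_d (fn_form (\<lambda>_. r)) p vs = 0 p vs"
    by (simp add: ext_d_def frechet_derivative_const[THEN fun_cong])
qed

lemma grade_grade: "grade (grade \<omega>) = \<omega>"
  by (intro ext) (simp add: grade_def)

lemma contract_grade: "contract v (grade \<omega>) = - grade (contract v \<omega>)"
  by (intro ext) (simp add: contract_def grade_def)

text \<open>The summands of d evaluate the form on lists that are shorter by one, whence the
  opposite sign.\<close>

lemma ext_d_grade:
  assumes "diff_form \<omega>" shows "ext_d (grade \<omega>) = - grade (ext_d \<omega>)"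
proof (intro ext)
  fix p and vs :: "'a list"
  have "(-1) ^ length (take i vs @ drop (Suc i) vs) = - ((-1) ^ length vs :: real)"
    if "i < length vs" for i using that by (cases vs) simp_all
  then have "(-1) ^ i * frechet_derivative (\<lambda>q. grade \<omega> q (take i vs @ drop (Suc i) vs)) (at p) (vs ! i)
      = - ((-1) ^ length vs) * ((-1) ^ i *
        frechet_derivative (\<lambda>q. \<omega> q (take i vs @ drop (Suc i) vs)) (at p) (vs ! i))"
    if "i < length vs" for i
    unfolding grade_def frechet_derivative_cmult_form[OF assms] using that
    by (simp only: mult.left_commute)
  then have "ext_d (grade \<omega>) p vs = (\<Sum>i<length vs. - ((-1) ^ length vs) * ((-1) ^ i *
        frechet_derivative (\<lambda>q. \<omega> q (take i vs @ drop (Suc i) vs)) (at p) (vs ! i)))"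
    unfolding ext_d_def by (intro sum.cong refl) simp
  also have "\<dots> = - ((-1) ^ length vs) * ext_d \<omega> p vs"
    unfolding ext_d_def sum_distrib_left ..
  finally show "ext_d (grade \<omega>) p vs = (- grade (ext_d \<omega>)) p vs"
    by (simp add: grade_def)
qed

text \<open>After contraction with v, the statement for the pair reduces to directional derivatives
  and to the statements for (\<open>contract v \<omega>\<close>, \<open>\<eta>\<close>) and
  (\<open>grade \<omega>\<close>, \<open>contract v \<eta>\<close>); the induction therefore has to
  vary both forms.\<close>

lemma ext_d_wedge:
  assumes "diff_form \<omega>" "diff_form \<eta>"
  shows "ext_d (\<omega> \<and>\<^sub>f \<eta>) = ext_d \<omega> \<and>\<^sub>f \<eta> + grade \<omega> \<and>\<^sub>f ext_d \<eta>"
proof (intro ext)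
  fix p vs
  show "ext_d (\<omega> \<and>\<^sub>f \<eta>) p vs = (ext_d \<omega> \<and>\<^sub>f \<eta> + grade \<omega> \<and>\<^sub>f ext_d \<eta>) p vs"
    using assms
  proof (induction vs arbitrary: \<omega> \<eta>)
    case Nil
    then show ?case by (simp add: ext_d_Nil wedge_Nil)
  next
    case (Cons v vs)
    note d = Cons.prems Cons.prems[THEN diff_form_contract[of _ v]] Cons.prems[THEN diff_form_grade]
    have c: "contract v (ext_d \<omega>) = dir_deriv v \<omega> - ext_d (contract v \<omega>)" for \<omega> :: "'a form"
      by (intro ext) (simp add: ext_d_Cons contract_def[of _ "ext_d \<omega>"])
    show ?case
      unfolding ext_d_Cons contract_wedge plus_fun_apply
        ext_d_add[OF diff_form_wedge[OF d(3,2)] diff_form_wedge[OF d(5,4)]]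
        Cons.IH[OF d(3,2)] Cons.IH[OF d(5,4)] dir_deriv_wedge[OF d(1,2)]
        wedge_Cons c contract_grade grade_grade ext_d_grade[OF d(1)]
        wedge_distribs
      by (simp add: wedge_distribs)
  qed
qed

lemma grade_one_form: "one_form \<alpha> \<Longrightarrow> grade \<alpha> = - \<alpha>"
proof (intro ext)
  fix p vs assume "one_form \<alpha>"
  then show "grade \<alpha> p vs = (- \<alpha>) p vs"
    by (cases "length vs = 1") (auto simp: grade_def one_form_def)
qed

lemma ext_d_wedge_one_form:
  assumes "one_form \<alpha>" "diff_form \<alpha>" "diff_form \<eta>"
  shows "ext_d (\<alpha> \<and>\<^sub>f \<eta>) = ext_d \<alpha> \<and>\<^sub>f \<eta> - \<alpha> \<and>\<^sub>f ext_d \<eta>"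
  using ext_d_wedge[OF assms(2,3)] by (simp add: grade_one_form[OF assms(1)] wedge_distribs)

section \<open>Orthonormal coframes\<close>

text \<open>Indices stay the numerals 1 to 7 instead of turning into \<open>Suc 0\<close>, and
  wedges are evaluated by the degree one rule instead of the two-term recursion.\<close>

declare One_nat_def [simp del] wedge_at.simps(2) [simp del]

lemma atLeastAtMost_1_7: "{1..7::nat} = {1, 2, 3, 4, 5, 6, 7}"
  by auto

lemma sum_1_7: "(\<Sum>i=1..7::nat. f i) = f 1 + f 2 + f 3 + f 4 + f 5 + f 6 + f 7"
  for f :: "nat \<Rightarrow> 'x::comm_monoid_add"
  unfolding atLeastAtMost_1_7 by (simp add: add.assoc)

lemma ball_1_7: "(\<forall>i\<in>{1..7::nat}. P i) \<longleftrightarrow> P 1 \<and> P 2 \<and> P 3 \<and> P 4 \<and> P 5 \<and> P 6 \<and> P 7"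
  unfolding atLeastAtMost_1_7 by simp

lemma wedge_at_degree1_zero:
  assumes "degree1 f" "\<And>v. v \<in> set vs \<Longrightarrow> f [v] = 0"
  shows "wedge_at vs f g = 0"
  using assms(2)
proof (induction vs arbitrary: g)
  case Nil
  show ?case using assms(1) by (simp add: degree1_def)
next
  case (Cons v vs)
  then show ?case by (simp add: wedge_at_degree1_Cons[OF assms(1)])
qed

text \<open>The first factor sees only u, and the sign counts the arguments that u has to pass. This
  fits arguments taken from a dual frame.\<close>

lemma wedge_at_degree1_single:
  assumes "degree1 f" "f [u] = 1" "\<And>v. v \<in> set us \<union> set vs \<Longrightarrow> f [v] = 0"
  shows "wedge_at (us @ u # vs) f g = (-1) ^ length us * g (us @ vs)"
  using assms(3)
proof (induction us arbitrary: g)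
  case Nil
  then show ?case
    by (simp add: wedge_at_degree1_Cons[OF assms(1)] assms(2) wedge_at_degree1_zero[OF assms(1)])
next
  case (Cons v us)
  then show ?case by (simp add: wedge_at_degree1_Cons[OF assms(1)])
qed

lemma wedge_at_sum_right:
  "finite I \<Longrightarrow> wedge_at vs f (\<lambda>ws. \<Sum>i\<in>I. c i * g i ws) = (\<Sum>i\<in>I. c i * wedge_at vs f (g i))"
  by (induction I rule: finite_induct)
    (simp_all add: wedge_at_zero_right wedge_at_add_right wedge_at_mult_right)

text \<open>Laplace expansion along the row of f. With the column expansion
  \<open>wedge_list_column\<close> it yields the symmetry of Gram determinants.\<close>

lemma wedge_at_row:
  assumes "degree1 f"
  shows "wedge_at vs f g = (\<Sum>i<length vs. (-1) ^ i * f [vs ! i] * g (take i vs @ drop (Suc i) vs))"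
proof (induction vs arbitrary: g)
  case Nil
  show ?case using assms by (simp add: degree1_def)
next
  case (Cons v vs)
  then show ?case unfolding length_Cons sum.lessThan_Suc_shift
    by (simp add: wedge_at_degree1_Cons[OF assms] sum_negf)
qed

lemma wedge_degree:
  assumes "one_form \<alpha>" "\<And>ws. length ws \<noteq> n \<Longrightarrow> \<eta> p ws = 0" "length vs \<noteq> Suc n"
  shows "(\<alpha> \<and>\<^sub>f \<eta>) p vs = 0"
  unfolding wedge_eq wedge_at_row[OF one_form_degree1[OF assms(1)]]
  using assms(2,3) by (intro sum.neutral) auto

text \<open>Contraction with v is an antiderivation, so it removes one factor at a time with
  alternating signs: the Laplace expansion along the column of v.\<close>

lemma wedge_list_column:
  assumes "\<And>\<omega>. \<omega> \<in> set \<omega>s \<Longrightarrow> degree1 (\<omega> p)"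
  shows "wedge_list \<omega>s p (v # vs)
    = (\<Sum>i<length \<omega>s. ((-1) ^ i * (\<omega>s ! i) p [v]) * wedge_list (take i \<omega>s @ drop (Suc i) \<omega>s) p vs)"
  using assms
proof (induction \<omega>s arbitrary: vs)
  case Nil
  show ?case by (simp add: wedge_list_Nil fn_form_def)
next
  case (Cons \<omega> \<omega>s)
  have IH: "(\<lambda>ws. wedge_list \<omega>s p (v # ws)) = (\<lambda>ws. \<Sum>i<length \<omega>s.
      ((-1) ^ i * (\<omega>s ! i) p [v]) * wedge_list (take i \<omega>s @ drop (Suc i) \<omega>s) p ws)"
    using Cons by auto
  have "wedge_list (\<omega> # \<omega>s) p (v # vs) = \<omega> p [v] * wedge_list \<omega>s p vs
      - wedge_at vs (\<omega> p) (\<lambda>ws. wedge_list \<omega>s p (v # ws))"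
    using Cons.prems by (simp add: wedge_list_Cons wedge_eq wedge_at_degree1_Cons del: wedge_at.simps)
  then show ?case unfolding length_Cons sum.lessThan_Suc_shift IH
    by (simp add: wedge_at_sum_right wedge_list_Cons wedge_eq sum_negf)
qed

lemma wedge_list_cong_at:
  "list_all2 (\<lambda>\<omega> \<eta>. \<omega> p = \<eta> p) \<omega>s \<eta>s \<Longrightarrow> wedge_list \<omega>s p = wedge_list \<eta>s p"
  by (induction rule: list_all2_induct) (auto simp: wedge_list_Cons wedge_eq intro!: ext)

lemma degree1_flat: "degree1 (flat e v p)"
  unfolding degree1_def flat_def by (auto split: list.splits)

lemma flat_sym: "flat e u p [v] = flat e v p [u]"
  by (simp add: flat_def metric_def mult.commute)

text \<open>The Gram determinant is symmetric: expand one side along a row and the other along a column.\<close>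

lemma wedge_list_flat_sym:
  "wedge_list (map (flat e) us) p vs = wedge_list (map (flat e) vs) p us"
proof (induction us arbitrary: vs)
  case Nil
  show ?case
    by (cases vs) (simp_all add: wedge_list_Nil wedge_list_Cons fn_form_def wedge_eq
        degree1_flat[unfolded degree1_def])
next
  case (Cons u us)
  have "wedge_list (map (flat e) (u # us)) p vs = (\<Sum>i<length vs. (-1) ^ i * flat e u p [vs ! i]
      * wedge_list (map (flat e) us) p (take i vs @ drop (Suc i) vs))"
    by (simp add: wedge_list_Cons wedge_eq wedge_at_row[OF degree1_flat])
  also have "\<dots> = (\<Sum>i<length vs. (-1) ^ i * (map (flat e) vs ! i) p [u]
      * wedge_list (take i (map (flat e) vs) @ drop (Suc i) (map (flat e) vs)) p us)"
    by (intro sum.cong refl) (simp add: Cons.IH flat_sym[of e u] take_map drop_map)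
  also have "\<dots> = wedge_list (map (flat e) vs) p (u # us)"
    by (subst wedge_list_column) (auto simp: degree1_flat)
  finally show ?case .
qed

lemma coframe_prod_Nil: "coframe_prod e [] = fn_form (\<lambda>_. 1)"
  and coframe_prod_Cons: "coframe_prod e (i # is) = e i \<and>\<^sub>f coframe_prod e is"
  by (simp_all add: coframe_prod_def wedge_list_Nil wedge_list_Cons)

lemma one_form_zero: "one_form 0"
  by (simp add: one_form_def linear_iff)

lemma one_form_add: "one_form \<alpha> \<Longrightarrow> one_form \<beta> \<Longrightarrow> one_form (\<alpha> + \<beta>)"
  by (simp add: one_form_def linear_iff algebra_simps)

lemma one_form_smult: "one_form \<alpha> \<Longrightarrow> one_form (smult_form r \<alpha>)"
  by (simp add: one_form_def linear_iff fmult_def algebra_simps)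

lemma one_form_sum: "(\<And>i. i \<in> I \<Longrightarrow> one_form (\<alpha> i)) \<Longrightarrow> one_form (sum \<alpha> I)"
  by (induction I rule: infinite_finite_induct) (simp_all add: one_form_zero one_form_add)

lemma diff_form_sum: "(\<And>i. i \<in> I \<Longrightarrow> diff_form (\<alpha> i)) \<Longrightarrow> diff_form (sum \<alpha> I)"
  by (induction I rule: infinite_finite_induct) (simp_all add: diff_form_zero diff_form_add)

lemma ext_d_sum: "(\<And>i. i \<in> I \<Longrightarrow> diff_form (\<alpha> i)) \<Longrightarrow> ext_d (sum \<alpha> I) = (\<Sum>i\<in>I. ext_d (\<alpha> i))"
  by (induction I rule: infinite_finite_induct)
    (simp_all add: ext_d_zero ext_d_add diff_form_sum)

lemma sum_form_apply: "sum \<alpha> I p vs = (\<Sum>i\<in>I. \<alpha> i p vs)"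
  for \<alpha> :: "'i \<Rightarrow> 'v form"
  by (induction I rule: infinite_finite_induct) simp_all

lemma wedge_one_forms:
  assumes "one_form \<alpha>" "one_form \<beta>"
  shows "(\<alpha> \<and>\<^sub>f \<beta>) p [u, v] = \<alpha> p [u] * \<beta> p [v] - \<alpha> p [v] * \<beta> p [u]"
  using assms
  by (simp add: wedge_eq wedge_at_degree1_Cons one_form_degree1 one_form_def)

lemma wedge_one_forms3:
  assumes "one_form \<alpha>" "one_form \<beta>" "one_form \<gamma>"
  shows "(\<alpha> \<and>\<^sub>f \<beta> \<and>\<^sub>f \<gamma>) p [u, v, w]
    = \<alpha> p [u] * (\<beta> p [v] * \<gamma> p [w] - \<beta> p [w] * \<gamma> p [v])
    - \<alpha> p [v] * (\<beta> p [u] * \<gamma> p [w] - \<beta> p [w] * \<gamma> p [u])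
    + \<alpha> p [w] * (\<beta> p [u] * \<gamma> p [v] - \<beta> p [v] * \<gamma> p [u])"
  using assms
  by (simp add: wedge_eq wedge_eq[abs_def] wedge_at_degree1_Cons one_form_degree1 one_form_def algebra_simps
   )

text \<open>Makes the torsion term T(X, E_j, E_i) a one-form in X; u and v are vector fields since
  the frame varies with the point.\<close>

lemma one_form_wedge3_insert:
  assumes "one_form \<alpha>" "one_form \<beta>" "one_form \<gamma>"
  shows "one_form (\<lambda>p vs. (\<alpha> \<and>\<^sub>f \<beta> \<and>\<^sub>f \<gamma>) p (vs @ [u p, v p]))"
proof -
  have "(\<alpha> \<and>\<^sub>f \<beta> \<and>\<^sub>f \<gamma>) p ws = 0" if "length ws \<noteq> 3" for p ws
    using that assms
    by (intro wedge_degree[where n = 2] wedge_degree[where n = 1]) (auto simp: one_form_def)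
  moreover have "linear (\<lambda>w. (\<alpha> \<and>\<^sub>f \<beta> \<and>\<^sub>f \<gamma>) p [w, u, v])" for p u v
    using assms by (simp add: wedge_one_forms3 linear_iff one_form_def algebra_simps)
  ultimately show ?thesis by (simp add: one_form_def One_nat_def)
qed

lemma frame_comp_add: "frame_comp e (\<omega> + \<eta>) is p = frame_comp e \<omega> is p + frame_comp e \<eta> is p"
  and frame_comp_diff: "frame_comp e (\<omega> - \<eta>) is p = frame_comp e \<omega> is p - frame_comp e \<eta> is p"
  and frame_comp_minus: "frame_comp e (- \<omega>) is p = - frame_comp e \<omega> is p"
  and frame_comp_smult: "frame_comp e (smult_form r \<omega>) is p = r * frame_comp e \<omega> is p"
  and frame_comp_zero: "frame_comp e 0 is p = 0"
  and frame_comp_sum: "frame_comp e (sum \<alpha> I) is p = (\<Sum>i\<in>I. frame_comp e (\<alpha> i) is p)"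
  by (simp_all add: frame_comp_def fmult_def sum_form_apply)

lemmas frame_comp_linear = frame_comp_add frame_comp_diff frame_comp_minus frame_comp_smult
  frame_comp_zero frame_comp_sum

lemma hodge_add: "hodge e (\<omega> + \<eta>) = hodge e \<omega> + hodge e \<eta>"
  and hodge_diff: "hodge e (\<omega> - \<eta>) = hodge e \<omega> - hodge e \<eta>"
  and hodge_smult: "hodge e (smult_form r \<omega>) = smult_form r (hodge e \<omega>)"
  by (intro ext; simp add: hodge_def wedge_distribs frame_comp_linear fmult_def)+

definition kdelta :: "nat \<Rightarrow> nat \<Rightarrow> real" where
  "kdelta i j = (if i = j then 1 else 0)"

text \<open>That the space has dimension 7 is not an assumption but follows from the unique dual
  vectors, see \<open>frame_expansion\<close>.\<close>

locale coframe =
  fixes e :: "nat \<Rightarrow> 'v::real_normed_vector form"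
  assumes one_form_e: "i \<in> {1..7} \<Longrightarrow> one_form (e i)"
    and diff_form_e: "i \<in> {1..7} \<Longrightarrow> diff_form (e i)"
    and dual_frame_ex1: "i \<in> {1..7} \<Longrightarrow> \<exists>!v. \<forall>j\<in>{1..7}. e j p [v] = (if j = i then 1 else 0)"
begin

lemma e_frame: "i \<in> {1..7} \<Longrightarrow> j \<in> {1..7} \<Longrightarrow> e j p [frame e i p] = kdelta j i"
  using theI'[OF dual_frame_ex1[of i p]] by (simp add: frame_def kdelta_def)

lemma e_linear: "i \<in> {1..7} \<Longrightarrow> linear (\<lambda>v. e i p [v])"
  using one_form_e by (simp add: one_form_def)

text \<open>If the coframe does not separate u and v, then E_1 + (u - v) satisfies the equations
  that determine E_1, so uniqueness gives u = v.\<close>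

lemma coframe_eqI:
  assumes "\<And>i. i \<in> {1..7} \<Longrightarrow> e i p [u] = e i p [v]"
  shows "u = v"
proof -
  have "e j p [frame e 1 p + (u - v)] = (if j = 1 then 1 else 0)" if "j \<in> {1..7}" for j
    using assms that e_frame[of 1 j p]
    by (simp add: linear_add[OF e_linear] linear_diff[OF e_linear] kdelta_def)
  moreover have "e j p [frame e 1 p] = (if j = 1 then 1 else 0)" if "j \<in> {1..7}" for j
    using that e_frame[of 1 j p] by (simp add: kdelta_def)
  ultimately have "frame e 1 p + (u - v) = frame e 1 p"
    using the1_equality[OF dual_frame_ex1[of 1 p]] by (metis (no_types, lifting) atLeastAtMost_iff one_le_numeral order_refl)
  then show ?thesis by simp
qed

lemma e_frame_sum:
  assumes "i \<in> {1..7}"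
  shows "e i p [\<Sum>k=1..7. c k *\<^sub>R frame e k p] = c i"
  using assms
  by (simp add: linear_sum[OF e_linear] linear_scale[OF e_linear] e_frame kdelta_def
      if_distrib cong: if_cong)

lemma frame_expansion: "v = (\<Sum>k=1..7. e k p [v] *\<^sub>R frame e k p)"
  by (rule coframe_eqI[of p]) (simp only: e_frame_sum)

lemma one_form_expansion:
  assumes "one_form \<alpha>"
  shows "\<alpha> p [v] = (\<Sum>k=1..7. e k p [v] * \<alpha> p [frame e k p])"
proof -
  have l: "linear (\<lambda>v. \<alpha> p [v])" using assms by (simp add: one_form_def)
  have "\<alpha> p [v] = \<alpha> p [\<Sum>k=1..7. e k p [v] *\<^sub>R frame e k p]"
    by (subst frame_expansion[of v p]) (rule refl)
  also have "\<dots> = (\<Sum>k=1..7. e k p [v] * \<alpha> p [frame e k p])"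
    by (simp add: linear_sum[OF l] linear_scale[OF l])
  finally show ?thesis .
qed

lemma one_form_eqI:
  assumes "one_form \<alpha>" "one_form \<beta>"
    and "\<And>p m. m \<in> {1..7} \<Longrightarrow> \<alpha> p [frame e m p] = \<beta> p [frame e m p]"
  shows "\<alpha> = \<beta>"
proof (intro ext)
  fix p vs show "\<alpha> p vs = \<beta> p vs"
  proof (cases "length vs = 1")
    case True
    then obtain v where "vs = [v]" by (auto simp: length_Suc_conv One_nat_def)
    then show ?thesis
      using assms(3) by (simp add: one_form_expansion[OF assms(1), of p v] one_form_expansion[OF assms(2), of p v])
  next
    case False
    then show ?thesis using assms by (simp add: one_form_def)
  qed
qed

text \<open>With right-nested products these rules sort monomials by index; the second version of
  each handles a pair followed by further factors. Polynomial identities in the coframe are then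
  settled by comparing coefficients.\<close>

lemma wedge_e_sort:
  assumes "i \<in> {1..7}" "j \<in> {1..7}" "i < j"
  shows "e j \<and>\<^sub>f e i = - (e i \<and>\<^sub>f e j)" "e j \<and>\<^sub>f e i \<and>\<^sub>f \<eta> = - (e i \<and>\<^sub>f e j \<and>\<^sub>f \<eta>)"
  using assms wedge_anticomm wedge_anticomm_left one_form_e by blast+

lemma wedge_e_self:
  assumes "i \<in> {1..7}" shows "e i \<and>\<^sub>f e i = 0" "e i \<and>\<^sub>f e i \<and>\<^sub>f \<eta> = 0"
  using assms wedge_self wedge_self_left one_form_e by blast+

text \<open>Among distinct frame vectors \<open>e i\<close> sees only E_i, so that index is deleted,
  with one sign for every index in front of it. On numeral lists this computes components by
  rewriting.\<close>

lemma frame_comp_wedge_e: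
  assumes "i \<in> {1..7}" "set ks \<subseteq> {1..7}" "distinct ks"
  shows "frame_comp e (e i \<and>\<^sub>f \<eta>) ks p = (if i \<in> set ks
    then (-1) ^ length (takeWhile (\<lambda>k. k \<noteq> i) ks) * frame_comp e \<eta> (remove1 i ks) p else 0)"
proof (cases "i \<in> set ks")
  case True
  then obtain xs ys where ks: "ks = xs @ i # ys" "i \<notin> set xs"
    by (meson split_list_first)
  have tw: "takeWhile (\<lambda>k. k \<noteq> i) ks = xs"
    using ks by (auto simp: takeWhile_tail)
  have z: "e i p [v] = 0" if v: "v \<in> set (map (\<lambda>k. frame e k p) xs) \<union> set (map (\<lambda>k. frame e k p) ys)" for v
  proof -
    from v obtain k where k: "k \<in> set xs \<union> set ys" "v = frame e k p" by auto
    then have "k \<noteq> i" "k \<in> {1..7}" using ks assms(2,3) by auto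
    then show ?thesis using k e_frame[of k i p] assms(1) by (simp add: kdelta_def)
  qed
  have "frame_comp e (e i \<and>\<^sub>f \<eta>) ks p = (-1) ^ length xs * \<eta> p (map (\<lambda>k. frame e k p) (xs @ ys))"
    unfolding frame_comp_def wedge_eq ks map_append list.map
    by (subst wedge_at_degree1_single[OF one_form_degree1[OF one_form_e[OF assms(1)]]])
      (use z e_frame[of i i p] assms(1) in \<open>simp_all add: kdelta_def\<close>)
  moreover have "remove1 i ks = xs @ ys" using ks by (simp add: remove1_append)
  ultimately show ?thesis using True by (simp only: tw if_True frame_comp_def)
next
  case False
  have "e i p [v] = 0" if "v \<in> set (map (\<lambda>k. frame e k p) ks)" for v
    using that False e_frame[of _ i p] assms(1,2) by (auto simp: kdelta_def)
  then have "wedge_at (map (\<lambda>k. frame e k p) ks) (e i p) (\<eta> p) = 0"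
    by (rule wedge_at_degree1_zero[OF one_form_degree1[OF one_form_e[OF assms(1)]]])
  then show ?thesis using False by (simp add: frame_comp_def wedge_eq)
qed

text \<open>The first assumption says that \<open>js\<close> is complementary to \<open>is\<close>,
  with c the sign of the combined permutation. The star at vectors \<open>vs\<close> is then c times
  the product of the flats of \<open>vs\<close> at the frame vectors of \<open>js\<close>; by Gram
  symmetry the two lists may be exchanged, and the flat of E_j is e^j.\<close>

lemma hodge_coframe_prod:
  assumes "\<And>p \<eta>. frame_comp e (coframe_prod e is \<and>\<^sub>f \<eta>) [1, 2, 3, 4, 5, 6, 7] p = c * frame_comp e \<eta> js p"
    and "set js \<subseteq> {1..7}"
  shows "hodge e (coframe_prod e is) = smult_form c (coframe_prod e js)"
proof (intro ext)
  fix p vs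
  have flat_frame: "flat e (frame e j p) p = e j p" if "j \<in> {1..7}" for j
  proof
    fix ws :: "'v list"
    have "flat e (frame e j p) p [w] = e j p [w]" for w
      using that by (simp add: flat_def metric_def e_frame kdelta_def if_distrib[of "\<lambda>x. x * _"] cong: if_cong)
    then show "flat e (frame e j p) p ws = e j p ws"
      using one_form_e[OF that]
      by (cases "length ws = 1") (auto simp: length_Suc_conv One_nat_def one_form_def flat_def split: list.splits)
  qed
  have "hodge e (coframe_prod e is) p vs = c * wedge_list (map (flat e) (map (\<lambda>i. frame e i p) js)) p vs"
    unfolding hodge_def assms(1) unfolding frame_comp_def
    by (rule arg_cong[where f = "(*) c"], rule wedge_list_flat_sym)
  also have "wedge_list (map (flat e) (map (\<lambda>i. frame e i p) js)) p = wedge_list (map e js) p"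
    using assms(2) by (intro wedge_list_cong_at) (auto simp: list_all2_map1 list_all2_map2 list_all2_same flat_frame)
  finally show "hodge e (coframe_prod e is) p vs = smult_form c (coframe_prod e js) p vs"
    by (simp add: fmult_def coframe_prod_def)
qed

lemma frame_comp_e2:
  assumes "i \<in> {1..7}" "j \<in> {1..7}" "k \<in> {1..7}" "l \<in> {1..7}"
  shows "frame_comp e (e i \<and>\<^sub>f e j) [k, l] p = kdelta i k * kdelta j l - kdelta i l * kdelta j k"
  using assms by (simp add: frame_comp_def wedge_one_forms one_form_e e_frame)

lemma frame_comp_e3:
  assumes "i \<in> {1..7}" "j \<in> {1..7}" "k \<in> {1..7}" "l \<in> {1..7}" "m \<in> {1..7}" "n \<in> {1..7}"
  shows "frame_comp e (e i \<and>\<^sub>f e j \<and>\<^sub>f e k) [l, m, n] p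
    = kdelta i l * (kdelta j m * kdelta k n - kdelta j n * kdelta k m)
    - kdelta i m * (kdelta j l * kdelta k n - kdelta j n * kdelta k l)
    + kdelta i n * (kdelta j l * kdelta k m - kdelta j m * kdelta k l)"
  using assms by (simp add: frame_comp_def wedge_one_forms3 one_form_e e_frame)

lemma frame_comp_coframe_prod:
  assumes "sorted_wrt (<) is" "sorted_wrt (<) js" "set is \<subseteq> {1..7}" "set js \<subseteq> {1..7}"
  shows "frame_comp e (coframe_prod e is) js p = (if is = js then 1 else 0)"
  using assms
proof (induction "is" arbitrary: js)
  case Nil
  then show ?case by (simp add: coframe_prod_Nil frame_comp_def fn_form_def)
next
  case (Cons i "is")
  have d: "distinct js" using Cons.prems(2) by (simp add: strict_sorted_iff)
  note fc = frame_comp_wedge_e[of i js "coframe_prod e is", OF _ Cons.prems(4) d]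
  show ?case
  proof (cases "i \<in> set js")
    case False
    then show ?thesis using Cons.prems by (auto simp: coframe_prod_Cons fc)
  next
    case True
    then obtain xs ys where js: "js = xs @ i # ys" "i \<notin> set xs"
      by (meson split_list_first)
    have "remove1 i js = xs @ ys" "takeWhile (\<lambda>k. k \<noteq> i) js = xs"
      using js by (auto simp: remove1_append takeWhile_tail)
    moreover have "frame_comp e (coframe_prod e is) (xs @ ys) p = (if is = xs @ ys then 1 else 0)"
      using Cons.prems js by (intro Cons.IH) (auto simp: sorted_wrt_append)
    ultimately have eq: "frame_comp e (coframe_prod e (i # is)) js p
        = (-1) ^ length xs * (if is = xs @ ys then 1 else 0)"
      using Cons.prems(3) True by (simp only: coframe_prod_Cons fc[of p] if_True set_simps insert_subset)
    show ?thesis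
    proof (cases xs)
      case Nil
      then show ?thesis unfolding eq unfolding js by simp
    next
      \<comment> \<open>Here \<open>js\<close> starts with some x < i, whereas all of
        \<open>is\<close> exceeds i: neither \<open>is\<close> nor \<open>i # is\<close> can begin
        with x, so both sides vanish.\<close>
      case (Cons x xs')
      then have "x < i" "is \<noteq> xs @ ys"
        using Cons.prems js by (auto simp: sorted_wrt_append)
      then show ?thesis unfolding eq unfolding js Cons by simp
    qed
  qed
qed

end

section \<open>Coframes with the structure equations of \<open>H(3,1)\<close>\<close>

text \<open>Skew matrix with blocks on the planes 12, 34, 56. It serves both for the components of
  de^7 (parameters a, b, c) and for the coefficients of the connections, all of which are multiples
  of e^7.\<close>

definition rot :: "real \<Rightarrow> real \<Rightarrow> real \<Rightarrow> nat \<Rightarrow> nat \<Rightarrow> real" where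
  "rot x y z i j =
     (if (i, j) = (1, 2) then x else if (i, j) = (2, 1) then - x
      else if (i, j) = (3, 4) then y else if (i, j) = (4, 3) then - y
      else if (i, j) = (5, 6) then z else if (i, j) = (6, 5) then - z else 0)"

lemma rot_skew: "rot x y z i j = - rot x y z j i"
  by (simp add: rot_def)

lemma rot_7: "rot x y z 7 j = 0" "rot x y z i 7 = 0"
  by (simp_all add: rot_def)

lemma rot_outside: "i \<notin> {1..7} \<or> j \<notin> {1..7} \<Longrightarrow> rot x y z i j = 0"
  by (auto simp: rot_def)

lemma rot_uminus: "rot (- x) (- y) (- z) i j = rot x y z j i"
  by (simp add: rot_def)

lemma rot_kdelta:
  "rot x y z i j = x * (kdelta 1 i * kdelta 2 j - kdelta 1 j * kdelta 2 i)
     + y * (kdelta 3 i * kdelta 4 j - kdelta 3 j * kdelta 4 i)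
     + z * (kdelta 5 i * kdelta 6 j - kdelta 5 j * kdelta 6 i)"
  by (simp add: rot_def kdelta_def)

lemma rot_diag: "rot x y z i i = 0"
  by (simp add: rot_def)

lemma kdelta_eval: "i \<noteq> j \<Longrightarrow> kdelta i j = 0" "kdelta i i = 1"
  by (simp_all add: kdelta_def)

lemma kdelta_sym: "kdelta i j = kdelta j i"
  by (simp add: kdelta_def)

lemma greaterThanAtMost_7:
  "{1<..7::nat} = {2, 3, 4, 5, 6, 7}" "{2<..7::nat} = {3, 4, 5, 6, 7}" "{3<..7::nat} = {4, 5, 6, 7}"
  "{4<..7::nat} = {5, 6, 7}" "{5<..7::nat} = {6, 7}" "{6<..7::nat} = {7}" "{7<..7::nat} = {}"
  by auto

lemma sum_rot_square: "(\<Sum>i=1..7. \<Sum>j\<in>{i<..7}. (rot x y z i j)\<^sup>2) = x\<^sup>2 + y\<^sup>2 + z\<^sup>2"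
  by (simp add: sum_1_7 greaterThanAtMost_7 rot_def)

lemma smult_form_zero: "smult_form 0 \<omega> = 0"
  and smult_form_uminus: "smult_form (- r) \<omega> = - smult_form r \<omega>"
  and smult_form_smult: "smult_form r (smult_form s \<omega>) = smult_form (r * s) \<omega>"
  and smult_form_one: "smult_form 1 \<omega> = \<omega>"
  and smult_form_zero_right: "smult_form r 0 = 0"
  by (intro ext; simp add: fmult_def)+

lemma sum_smult_form: "(\<Sum>i\<in>I. smult_form (r i) \<omega>) = smult_form (\<Sum>i\<in>I. r i) \<omega>"
  by (intro ext) (simp add: sum_form_apply fmult_def sum_distrib_right)

lemma heis_connection_eq: "heis_connection e l m t i j = smult_form (rot l m t i j) (e 7)"
  by (simp add: heis_connection_def rot_def smult_form_zero smult_form_uminus)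

text \<open>The parameter c with a + b + c = 0 keeps the three planes on an equal footing. The
  structure equations are assumed in both dual forms: the exterior derivatives for the calculus of
  forms, the brackets for the torsion-free condition.\<close>

locale heis_frame = coframe e for e :: "nat \<Rightarrow> chart form" +
  fixes a b c :: real
  assumes abc: "a + b + c = 0"
    and ext_d_e: "i \<in> {1..6} \<Longrightarrow> ext_d (e i) = 0"
    and ext_d_e7: "ext_d (e 7) = smult_form a (e 1 \<and>\<^sub>f e 2) + smult_form b (e 3 \<and>\<^sub>f e 4)
      + smult_form c (e 5 \<and>\<^sub>f e 6)"
    and bracket: "i \<in> {1..7} \<Longrightarrow> j \<in> {1..7} \<Longrightarrow>
      lie_bracket (frame e i) (frame e j) p = - rot a b c i j *\<^sub>R frame e 7 p"
begin

abbreviation w :: "nat \<Rightarrow> nat \<Rightarrow> real" where "w \<equiv> rot a b c"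

lemma frame_comp_de7:
  "i \<in> {1..7} \<Longrightarrow> j \<in> {1..7} \<Longrightarrow> frame_comp e (ext_d (e 7)) [i, j] p = w i j"
  by (simp add: ext_d_e7 frame_comp_linear frame_comp_e2 rot_kdelta)

lemmas e_normalize = wedge_distribs wedge_assoc wedge_one_left wedge_one_right wedge_e_sort wedge_e_self
  coframe_prod_Cons coframe_prod_Nil

lemma ext_d_wedge_e:
  assumes "i \<in> {1..7}" "diff_form \<eta>"
  shows "ext_d (e i \<and>\<^sub>f \<eta>) = ext_d (e i) \<and>\<^sub>f \<eta> - e i \<and>\<^sub>f ext_d \<eta>"
  using assms one_form_e diff_form_e by (simp add: ext_d_wedge_one_form)

lemmas diff_form_intros = diff_form_add diff_form_diff diff_form_minus diff_form_smult
  diff_form_wedge diff_form_e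

lemmas ext_d_simps = ext_d_wedge_e ext_d_add ext_d_diff ext_d_minus ext_d_smult ext_d_e ext_d_e7
  diff_form_intros

definition Theta :: "chart form" where "Theta = G2_form e"

definition flux :: "chart form" where "flux = - hodge e (ext_d Theta)"

lemma Theta_eq:
  "Theta = e 1 \<and>\<^sub>f e 2 \<and>\<^sub>f e 7 + e 3 \<and>\<^sub>f e 4 \<and>\<^sub>f e 7 + e 5 \<and>\<^sub>f e 6 \<and>\<^sub>f e 7 + e 1 \<and>\<^sub>f e 3 \<and>\<^sub>f e 5
    - e 1 \<and>\<^sub>f e 4 \<and>\<^sub>f e 6 - e 2 \<and>\<^sub>f e 3 \<and>\<^sub>f e 6 - e 2 \<and>\<^sub>f e 4 \<and>\<^sub>f e 5"
  by (simp add: Theta_def G2_form_def e_normalize)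

text \<open>This is (e^12 + e^34 + e^56) wedge de^7. Its coefficients a + b, a + c, b + c are
  rewritten as -c, -b, -a, which makes the star of this form equal to minus
  \<open>flux_eq_e\<close>.\<close>

lemma ext_d_Theta:
  "ext_d Theta = - smult_form c (e 1 \<and>\<^sub>f e 2 \<and>\<^sub>f e 3 \<and>\<^sub>f e 4) - smult_form b (e 1 \<and>\<^sub>f e 2 \<and>\<^sub>f e 5 \<and>\<^sub>f e 6)
    - smult_form a (e 3 \<and>\<^sub>f e 4 \<and>\<^sub>f e 5 \<and>\<^sub>f e 6)"
proof -
  have "b = - a - c" using abc by simp
  then show ?thesis
    by (simp add: Theta_eq ext_d_simps e_normalize) (intro ext, simp add: fmult_def algebra_simps)
qed

lemma hodge_e:
  "hodge e (e 1 \<and>\<^sub>f e 2 \<and>\<^sub>f e 7) = e 3 \<and>\<^sub>f e 4 \<and>\<^sub>f e 5 \<and>\<^sub>f e 6"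
  "hodge e (e 3 \<and>\<^sub>f e 4 \<and>\<^sub>f e 7) = e 1 \<and>\<^sub>f e 2 \<and>\<^sub>f e 5 \<and>\<^sub>f e 6"
  "hodge e (e 5 \<and>\<^sub>f e 6 \<and>\<^sub>f e 7) = e 1 \<and>\<^sub>f e 2 \<and>\<^sub>f e 3 \<and>\<^sub>f e 4"
  "hodge e (e 1 \<and>\<^sub>f e 3 \<and>\<^sub>f e 5) = - (e 2 \<and>\<^sub>f e 4 \<and>\<^sub>f e 6 \<and>\<^sub>f e 7)"
  "hodge e (e 1 \<and>\<^sub>f e 4 \<and>\<^sub>f e 6) = - (e 2 \<and>\<^sub>f e 3 \<and>\<^sub>f e 5 \<and>\<^sub>f e 7)"
  "hodge e (e 2 \<and>\<^sub>f e 3 \<and>\<^sub>f e 6) = - (e 1 \<and>\<^sub>f e 4 \<and>\<^sub>f e 5 \<and>\<^sub>f e 7)"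
  "hodge e (e 2 \<and>\<^sub>f e 4 \<and>\<^sub>f e 5) = - (e 1 \<and>\<^sub>f e 3 \<and>\<^sub>f e 6 \<and>\<^sub>f e 7)"
  "hodge e (e 1 \<and>\<^sub>f e 2 \<and>\<^sub>f e 3 \<and>\<^sub>f e 4) = e 5 \<and>\<^sub>f e 6 \<and>\<^sub>f e 7"
  "hodge e (e 1 \<and>\<^sub>f e 2 \<and>\<^sub>f e 5 \<and>\<^sub>f e 6) = e 3 \<and>\<^sub>f e 4 \<and>\<^sub>f e 7"
  "hodge e (e 3 \<and>\<^sub>f e 4 \<and>\<^sub>f e 5 \<and>\<^sub>f e 6) = e 1 \<and>\<^sub>f e 2 \<and>\<^sub>f e 7"
  using hodge_coframe_prod[of "[1, 2, 7]" 1 "[3, 4, 5, 6]"]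
    hodge_coframe_prod[of "[3, 4, 7]" 1 "[1, 2, 5, 6]"]
    hodge_coframe_prod[of "[5, 6, 7]" 1 "[1, 2, 3, 4]"]
    hodge_coframe_prod[of "[1, 3, 5]" "-1" "[2, 4, 6, 7]"]
    hodge_coframe_prod[of "[1, 4, 6]" "-1" "[2, 3, 5, 7]"]
    hodge_coframe_prod[of "[2, 3, 6]" "-1" "[1, 4, 5, 7]"]
    hodge_coframe_prod[of "[2, 4, 5]" "-1" "[1, 3, 6, 7]"]
    hodge_coframe_prod[of "[1, 2, 3, 4]" 1 "[5, 6, 7]"]
    hodge_coframe_prod[of "[1, 2, 5, 6]" 1 "[3, 4, 7]"]
    hodge_coframe_prod[of "[3, 4, 5, 6]" 1 "[1, 2, 7]"]
  by (simp_all add: coframe_prod_Cons coframe_prod_Nil wedge_assoc wedge_one_left wedge_one_right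
      frame_comp_wedge_e smult_form_one smult_form_uminus)

lemma hodge_Theta:
  "hodge e Theta = e 3 \<and>\<^sub>f e 4 \<and>\<^sub>f e 5 \<and>\<^sub>f e 6 + e 1 \<and>\<^sub>f e 2 \<and>\<^sub>f e 5 \<and>\<^sub>f e 6 + e 1 \<and>\<^sub>f e 2 \<and>\<^sub>f e 3 \<and>\<^sub>f e 4
    - e 2 \<and>\<^sub>f e 4 \<and>\<^sub>f e 6 \<and>\<^sub>f e 7 + e 2 \<and>\<^sub>f e 3 \<and>\<^sub>f e 5 \<and>\<^sub>f e 7 + e 1 \<and>\<^sub>f e 4 \<and>\<^sub>f e 5 \<and>\<^sub>f e 7
    + e 1 \<and>\<^sub>f e 3 \<and>\<^sub>f e 6 \<and>\<^sub>f e 7"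
  by (simp add: Theta_eq hodge_add hodge_diff hodge_e)

lemma flux_eq_e:
  "flux = smult_form a (e 1 \<and>\<^sub>f e 2 \<and>\<^sub>f e 7) + smult_form b (e 3 \<and>\<^sub>f e 4 \<and>\<^sub>f e 7)
    + smult_form c (e 5 \<and>\<^sub>f e 6 \<and>\<^sub>f e 7)"
  unfolding flux_def ext_d_Theta
  by (simp add: hodge_diff hodge_e hodge_smult flip: smult_form_uminus)

text \<open>The triples 246, 235, 145, 136 in the star of \<open>Theta\<close> meet each of the
  planes 12, 34, 56, so their products with de^7 vanish; the remaining terms are closed. In the
  second condition the pairing of complementary planes leaves only a + b + c.\<close>

lemma cocalibrated: "cocalibrated_pure_type e Theta"
proof -
  have "ext_d (hodge e Theta) = 0"
    by (simp add: hodge_Theta ext_d_simps e_normalize smult_form_zero_right)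
  moreover have "ext_d Theta \<and>\<^sub>f Theta = smult_form (- (a + b + c))
      (e 1 \<and>\<^sub>f e 2 \<and>\<^sub>f e 3 \<and>\<^sub>f e 4 \<and>\<^sub>f e 5 \<and>\<^sub>f e 6 \<and>\<^sub>f e 7)"
    unfolding ext_d_Theta unfolding Theta_eq
    by (simp add: e_normalize) (intro ext, simp add: fmult_def algebra_simps)
  ultimately show ?thesis
    by (simp add: cocalibrated_pure_type_def abc smult_form_zero)
qed

text \<open>All connection forms are multiples of e^7, so the quadratic part of the curvature
  vanishes.\<close>

lemma curvature_heis_connection:
  "curvature (heis_connection e l m t) i j = smult_form (rot l m t i j) (ext_d (e 7))"
  by (simp add: curvature_def heis_connection_eq ext_d_smult diff_form_e wedge_distribs wedge_e_self
      smult_form_zero_right)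

text \<open>Terms of the star containing e^7 are killed for the reason that makes them closed; each
  plane pairs with its complementary four-form, giving a + b + c.\<close>

lemma de7_wedge_hodge_Theta: "ext_d (e 7) \<and>\<^sub>f hodge e Theta = 0"
proof -
  have "ext_d (e 7) \<and>\<^sub>f hodge e Theta
      = smult_form (a + b + c) (e 1 \<and>\<^sub>f e 2 \<and>\<^sub>f e 3 \<and>\<^sub>f e 4 \<and>\<^sub>f e 5 \<and>\<^sub>f e 6)"
    by (simp add: ext_d_e7 hodge_Theta e_normalize) (intro ext, simp add: fmult_def algebra_simps)
  then show ?thesis by (simp add: abc smult_form_zero)
qed

lemma instanton: "G2_instanton e Theta (heis_connection e l m t)"
  by (simp add: G2_instanton_def curvature_heis_connection wedge_fmult_left de7_wedge_hodge_Theta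
      smult_form_zero_right)

lemma pontryagin1_heis_connection:
  "pontryagin1 (heis_connection e l m t)
    = smult_form ((l\<^sup>2 + m\<^sup>2 + t\<^sup>2) / (8 * pi\<^sup>2)) (ext_d (e 7) \<and>\<^sub>f ext_d (e 7))"
  by (simp add: pontryagin1_def curvature_heis_connection wedge_fmult_left wedge_fmult_right
      smult_form_smult sum_smult_form flip: power2_eq_square sum_rot_square)

lemma ext_d_flux: "ext_d flux = ext_d (e 7) \<and>\<^sub>f ext_d (e 7)"
  by (simp add: flux_eq_e ext_d_simps e_normalize smult_form_smult)
    (intro ext, simp add: fmult_def algebra_simps)

lemma anomaly:
  assumes "l\<^sup>2 + m\<^sup>2 + t\<^sup>2 < 2 * (a\<^sup>2 + a * b + b\<^sup>2)"
  shows "anomaly_cancellation (4 / (2 * (a\<^sup>2 + a * b + b\<^sup>2) - l\<^sup>2 - m\<^sup>2 - t\<^sup>2)) flux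
    (heis_connection e (- a) (- b) (- c)) (heis_connection e l m t)"
proof -
  define D where "D = 2 * (a\<^sup>2 + a * b + b\<^sup>2) - l\<^sup>2 - m\<^sup>2 - t\<^sup>2"
  have c: "c = - a - b" using abc by simp
  \<comment> \<open>With c = -a - b the squares sum to 2(a^2 + ab + b^2). Hence the constant becomes
    2 pi^2 (4/D) D/(8 pi^2) = 1.\<close>
  have D: "a\<^sup>2 + b\<^sup>2 + c\<^sup>2 - (l\<^sup>2 + m\<^sup>2 + t\<^sup>2) = D"
    by (simp add: D_def c power2_eq_square algebra_simps)
  have "D > 0" using assms by (simp add: D_def)
  then have one: "2 * pi\<^sup>2 * (4 / D) * ((a\<^sup>2 + b\<^sup>2 + c\<^sup>2) / (8 * pi\<^sup>2) - (l\<^sup>2 + m\<^sup>2 + t\<^sup>2) / (8 * pi\<^sup>2)) = 1"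
    unfolding diff_divide_distrib[symmetric] D by simp
  have "x = 2 * pi\<^sup>2 * (4 / D) * ((a\<^sup>2 + b\<^sup>2 + c\<^sup>2) / (8 * pi\<^sup>2) * x - (l\<^sup>2 + m\<^sup>2 + t\<^sup>2) / (8 * pi\<^sup>2) * x)" for x
    unfolding left_diff_distrib[symmetric] mult.assoc[symmetric] one by simp
  then show ?thesis
    unfolding anomaly_cancellation_def ext_d_flux pontryagin1_heis_connection D_def[symmetric]
    by (intro ext) (simp only: fmult_def fun_diff_def power2_minus)
qed


subsection \<open>The Levi-Civita connection\<close>

text \<open>Koszul's formula for g(nabla_{E_i} E_j, E_k) with [E_i, E_j] = -w_ij E_7. The first
  index is the upper one, the second the direction of differentiation.\<close>

definition lc :: "nat \<Rightarrow> nat \<Rightarrow> nat \<Rightarrow> real" where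
  "lc k i j = (w i k * kdelta j 7 + w j k * kdelta i 7 - w i j * kdelta k 7) / 2"

definition lc_connection :: "chart connection" where
  "lc_connection i j = (if i \<in> {1..7} \<and> j \<in> {1..7} then \<Sum>m=1..7. smult_form (lc i m j) (e m) else 0)"

lemma lc_skew: "lc k i j = - lc j i k"
  using rot_skew[of a b c j k] by (simp add: lc_def field_simps)

lemma lc_torsion: "lc k i j - lc k j i = - w i j * kdelta k 7"
  using rot_skew[of a b c i j] by (simp add: lc_def field_simps)

lemma one_form_lc: "one_form (lc_connection i j)"
  unfolding lc_connection_def by (auto intro!: one_form_zero one_form_sum one_form_smult one_form_e)

lemma lc_connection_frame:
  "i \<in> {1..7} \<Longrightarrow> j \<in> {1..7} \<Longrightarrow> m \<in> {1..7} \<Longrightarrow> lc_connection i j p [frame e m p] = lc i m j"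
  by (simp add: lc_connection_def sum_form_apply fmult_def e_frame kdelta_def
      if_distrib[of "\<lambda>x. _ * x"] cong: if_cong)

lemma lc_connection_skew: "lc_connection i j = - lc_connection j i"
proof (cases "i \<in> {1..7} \<and> j \<in> {1..7}")
  case True
  have "(\<Sum>m=1..7. smult_form (lc i m j) (e m)) = (\<Sum>m=1..7. - smult_form (lc j m i) (e m))"
    by (simp only: lc_skew[of i _ j] smult_form_uminus)
  with True show ?thesis by (simp add: lc_connection_def sum_negf)
next
  case False
  then show ?thesis by (auto simp: lc_connection_def)
qed

lemma nabla_frame_comp:
  assumes "k \<in> {1..7}"
  shows "e k p [nabla_frame e \<sigma> i j p] = \<sigma> k j p [frame e i p]"
  using assms by (simp add: nabla_frame_def e_frame_sum)

lemma levi_civita_eq: "levi_civita e = lc_connection"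
  unfolding levi_civita_def
proof (rule the_equality, intro conjI allI ballI)
  show "connection_forms lc_connection"
    by (simp add: connection_forms_def one_form_lc) (simp add: lc_connection_def)
  show "lc_connection i j = - lc_connection j i" for i j
    by (rule lc_connection_skew)
  fix i j :: nat and p assume ij: "i \<in> {1..7}" "j \<in> {1..7}"
  show "nabla_frame e lc_connection i j p - nabla_frame e lc_connection j i p
      = lie_bracket (frame e i) (frame e j) p"
    using ij lc_torsion[of _ i j]
    by (intro coframe_eqI[of p])
      (simp add: bracket linear_diff[OF e_linear] linear_scale[OF e_linear] linear_neg[OF e_linear]
        nabla_frame_comp lc_connection_frame e_frame)
next
  fix \<sigma> assume *: "connection_forms \<sigma> \<and> (\<forall>i j. \<sigma> i j = - \<sigma> j i) \<and>
     (\<forall>i\<in>{1..7}. \<forall>j\<in>{1..7}. \<forall>p. nabla_frame e \<sigma> i j p - nabla_frame e \<sigma> j i p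
        = lie_bracket (frame e i) (frame e j) p)"
  then have conn: "connection_forms \<sigma>" by blast
  have "\<sigma> k j p [frame e i p] = lc k i j" if k: "i \<in> {1..7}" "j \<in> {1..7}" "k \<in> {1..7}" for i j k p
  proof -
    define d where "d k i j = \<sigma> k j p [frame e i p] - lc k i j" for k i j
    have sym: "d k i j = d k j i" if "i \<in> {1..7}" "j \<in> {1..7}" "k \<in> {1..7}" for i j k
    proof -
      have "e k p [nabla_frame e \<sigma> i j p - nabla_frame e \<sigma> j i p] = - w i j * kdelta k 7"
      proof -
        have "nabla_frame e \<sigma> i j p - nabla_frame e \<sigma> j i p = - w i j *\<^sub>R frame e 7 p"
          using * that by (simp only: bracket)
        then show ?thesis
          using that by (simp add: linear_scale[OF e_linear] linear_neg[OF e_linear] e_frame)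
      qed
      then show ?thesis
        using that lc_torsion[of k i j]
        by (simp add: d_def linear_diff[OF e_linear] nabla_frame_comp)
    qed
    have skew: "d k i j = - d j i k" for i j k
    proof -
      have "\<sigma> k j = - \<sigma> j k" using * by blast
      then show ?thesis using lc_skew[of k i j] by (simp add: d_def)
    qed
    \<comment> \<open>The difference of two solutions is symmetric in i, j (torsion) and skew in k,
      j (metric). Alternating three swaps of each kind returns to the same component with sign
      -1.\<close>
    have "d k i j = - d k i j"
      using sym[of i j k] skew[of k j i] sym[of j k i] skew[of i k j] sym[of k i j] skew[of j i k] k
      by simp
    then show ?thesis by (simp add: d_def)
  qed
  then have "\<sigma> k j = lc_connection k j" if "j \<in> {1..7}" "k \<in> {1..7}" for j k
    using conn that by (intro one_form_eqI one_form_lc) (auto simp: connection_forms_def lc_connection_frame)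
  moreover have "\<sigma> k j = lc_connection k j" if "j \<notin> {1..7} \<or> k \<notin> {1..7}" for j k
    using that conn by (auto simp: connection_forms_def lc_connection_def)
  ultimately show "\<sigma> = lc_connection" by blast
qed

end

section \<open>A Clifford module from the octonions\<close>

lemma exhaust_8:
  fixes x :: 8
  shows "x = 1 \<or> x = 2 \<or> x = 3 \<or> x = 4 \<or> x = 5 \<or> x = 6 \<or> x = 7 \<or> x = 8"
proof (induct x)
  case (of_int z)
  then have "0 \<le> z" and "z < 8" by simp_all
  then have "z = 0 \<or> z = 1 \<or> z = 2 \<or> z = 3 \<or> z = 4 \<or> z = 5 \<or> z = 6 \<or> z = 7" by arith
  then show ?case by auto
qed

lemma forall_8: "(\<forall>i::8. P i) \<longleftrightarrow> P 1 \<and> P 2 \<and> P 3 \<and> P 4 \<and> P 5 \<and> P 6 \<and> P 7 \<and> P 8"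
  by (metis exhaust_8)

lemma UNIV_8: "UNIV = {1, 2, 3, 4, 5, 6, 7, 8::8}"
  using exhaust_8 by auto

lemma sum_8: "sum f (UNIV::8 set) = f 1 + f 2 + f 3 + f 4 + f 5 + f 6 + f 7 + f 8"
  unfolding UNIV_8 by (simp add: ac_simps)

lemma vector_8 [simp]:
  fixes x1 :: "'x::zero"
  shows "(vector [x1, x2, x3, x4, x5, x6, x7, x8] :: 'x^8) $ 1 = x1"
    "(vector [x1, x2, x3, x4, x5, x6, x7, x8] :: 'x^8) $ 2 = x2"
    "(vector [x1, x2, x3, x4, x5, x6, x7, x8] :: 'x^8) $ 3 = x3"
    "(vector [x1, x2, x3, x4, x5, x6, x7, x8] :: 'x^8) $ 4 = x4"
    "(vector [x1, x2, x3, x4, x5, x6, x7, x8] :: 'x^8) $ 5 = x5"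
    "(vector [x1, x2, x3, x4, x5, x6, x7, x8] :: 'x^8) $ 6 = x6"
    "(vector [x1, x2, x3, x4, x5, x6, x7, x8] :: 'x^8) $ 7 = x7"
    "(vector [x1, x2, x3, x4, x5, x6, x7, x8] :: 'x^8) $ 8 = x8"
  unfolding vector_def by simp_all

text \<open>Identify \<open>real^8\<close> with the octonions, the last coordinate being the real part, and let the
  product of imaginary units be \<open>e\<^sub>i e\<^sub>j = - \<delta>\<^sub>i\<^sub>j - \<Sum>\<^sub>k \<Theta>\<^sub>i\<^sub>j\<^sub>k e\<^sub>k\<close>; \<open>octonion_mult i\<close> is left
  multiplication by \<open>e\<^sub>i\<close>.\<close>

definition octonion_mult :: "nat \<Rightarrow> real^8 \<Rightarrow> real^8" where
  "octonion_mult i x =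
     (if i = 1 then vector [x $ 8, x $ 7, x $ 5, - x $ 6, - x $ 3, x $ 4, - x $ 2, - x $ 1]
      else if i = 2 then vector [- x $ 7, x $ 8, - x $ 6, - x $ 5, x $ 4, x $ 3, x $ 1, - x $ 2]
      else if i = 3 then vector [- x $ 5, x $ 6, x $ 8, x $ 7, x $ 1, - x $ 2, - x $ 4, - x $ 3]
      else if i = 4 then vector [x $ 6, x $ 5, - x $ 7, x $ 8, - x $ 2, - x $ 1, x $ 3, - x $ 4]
      else if i = 5 then vector [x $ 3, - x $ 4, - x $ 1, x $ 2, x $ 8, x $ 7, - x $ 6, - x $ 5]
      else if i = 6 then vector [- x $ 4, - x $ 3, x $ 2, x $ 1, - x $ 7, x $ 8, x $ 5, - x $ 6]
      else if i = 7 then vector [x $ 2, - x $ 1, x $ 4, - x $ 3, x $ 6, - x $ 5, x $ 8, - x $ 7]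
      else 0)"

definition octonion_gamma :: "nat \<Rightarrow> real^8^8" where
  "octonion_gamma i = matrix (octonion_mult i)"

definition octonion_one :: "real^8" where
  "octonion_one = vector [0, 0, 0, 0, 0, 0, 0, 1]"

lemma linear_octonion_mult: "linear (octonion_mult i)"
  by (rule linearI) (simp_all add: octonion_mult_def vec_eq_iff forall_8)

lemma octonion_gamma_mult: "octonion_gamma i *v x = octonion_mult i x"
  using fun_cong[OF matrix_vector_mul(2)[OF linear_octonion_mult]] by (simp add: octonion_gamma_def)

lemma transpose_matrix_skew:
  fixes f :: "real^'n \<Rightarrow> real^'n"
  assumes "linear f" "\<And>x y. f x \<bullet> y = - (x \<bullet> f y)"
  shows "transpose (matrix f) = - matrix f"
proof -
  have "adjoint f = (\<lambda>x. - f x)"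
    by (rule adjoint_unique) (simp add: assms(2))
  then show ?thesis
    using matrix_adjoint[OF assms(1)] by (simp add: matrix_def vec_eq_iff)
qed

lemma octonion_mult_skew: "octonion_mult i x \<bullet> y = - (x \<bullet> octonion_mult i y)"
  by (simp add: octonion_mult_def inner_vec_def sum_8)

lemma octonion_mult_one:
  assumes "i \<in> {1..7}"
  shows "octonion_mult i octonion_one = vector [kdelta 1 i, kdelta 2 i, kdelta 3 i, kdelta 4 i,
    kdelta 5 i, kdelta 6 i, kdelta 7 i, 0]"
proof -
  have "i \<in> {1, 2, 3, 4, 5, 6, 7}" using assms by auto
  then show ?thesis
    by (auto simp: octonion_mult_def octonion_one_def kdelta_def vec_eq_iff forall_8)
qed

text \<open>Behind the relations is the alternative law of the octonions: e(ex) = (ee)x for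
  imaginary e, polarised. It is checked in coordinates for a generic x and all pairs of
  units.\<close>

lemma clifford_module_octonion: "clifford_module octonion_gamma"
proof -
  have "transpose (octonion_gamma i) = - octonion_gamma i" for i
    by (simp add: octonion_gamma_def transpose_matrix_skew linear_octonion_mult octonion_mult_skew)
  moreover have "\<forall>i\<in>{1..7}. \<forall>j\<in>{1..7}. octonion_mult i (octonion_mult j x)
      + octonion_mult j (octonion_mult i x) = (if i = j then - 2 *\<^sub>R x else 0)" for x
    unfolding ball_1_7 by (simp add: octonion_mult_def vec_eq_iff forall_8)
  then have "octonion_gamma i ** octonion_gamma j + octonion_gamma j ** octonion_gamma i
      = (if i = j then - mat 2 else 0)" if "i \<in> {1..7}" "j \<in> {1..7}" for i j
  proof -
    have "mat 2 *v x = 2 *\<^sub>R x" for x :: "real^8"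
      by (simp add: matrix_vector_mult_def mat_def vec_eq_iff if_distrib[of "\<lambda>x. x * _"] cong: if_cong)
    moreover have "(- A) *v x = - (A *v x)" for A :: "real^8^8" and x
      by (simp add: matrix_vector_mult_def vec_eq_iff sum_negf)
    ultimately show ?thesis
      using that \<open>\<And>x. \<forall>i\<in>{1..7}. \<forall>j\<in>{1..7}. octonion_mult i (octonion_mult j x)
        + octonion_mult j (octonion_mult i x) = (if i = j then - 2 *\<^sub>R x else 0)\<close>
      by (simp add: matrix_eq matrix_vector_mult_add_rdistrib octonion_gamma_mult
          matrix_vector_mul_assoc[symmetric])
  qed
  ultimately show ?thesis by (simp add: clifford_module_def)
qed

section \<open>Clifford action of forms\<close>

lemma sorted_wrt_subseqs:
  "sorted_wrt R xs \<Longrightarrow> ys \<in> set (subseqs xs) \<Longrightarrow> sorted_wrt R ys \<and> set ys \<subseteq> set xs"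
  by (induction xs arbitrary: ys) (fastforce simp: Let_def)+

lemma clifford_act_add:
    "clifford_act \<gamma> e (\<omega> + \<eta>) p s = clifford_act \<gamma> e \<omega> p s + clifford_act \<gamma> e \<eta> p s"
  and clifford_act_smult: "clifford_act \<gamma> e (smult_form r \<omega>) p s = r *\<^sub>R clifford_act \<gamma> e \<omega> p s"
  unfolding clifford_act_def frame_comp_linear
  by (simp_all only: scaleR_add_left sum_list_addf scaleR_scaleR[symmetric] scaleR_zero_left
      sum_list_0) (induction "subseqs [1, 2, 3, 4, 5, 6, 7::nat]", simp_all add: scaleR_add_right)

context coframe
begin

text \<open>The enumerated multi-indices are increasing and pairwise distinct, so exactly one
  summand survives.\<close>

lemma clifford_act_coframe_prod:
  assumes "is \<in> set (subseqs [1, 2, 3, 4, 5, 6, 7])"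
  shows "clifford_act \<gamma> e (coframe_prod e is) p s = foldr (\<lambda>i t. \<gamma> i *v t) is s"
proof -
  let ?S = "subseqs [1, 2, 3, 4, 5, 6, 7::nat]"
  have S: "\<forall>js\<in>set ?S. sorted_wrt (<) js \<and> set js \<subseteq> {1..7}"
  proof -
    have "sorted_wrt (<) [1, 2, 3, 4, 5, 6, 7::nat]" by simp
    moreover have "set [1, 2, 3, 4, 5, 6, 7::nat] \<subseteq> {1..7}" by simp
    ultimately show ?thesis using sorted_wrt_subseqs by blast
  qed
  have "distinct (map set ?S)" by (rule distinct_set_subseqs) simp
  then have d: "distinct ?S" using distinct_map by blast
  have "clifford_act \<gamma> e (coframe_prod e is) p s
      = (\<Sum>js\<in>set ?S. frame_comp e (coframe_prod e is) js p *\<^sub>R foldr (\<lambda>i t. \<gamma> i *v t) js s)"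
    unfolding clifford_act_def by (rule sum_list_distinct_conv_sum_set[OF d])
  also have "\<dots> = (\<Sum>js\<in>set ?S. if is = js then foldr (\<lambda>i t. \<gamma> i *v t) js s else 0)"
    by (intro sum.cong refl) (use S assms in \<open>simp add: frame_comp_coframe_prod del: subseqs.simps\<close>)
  also have "\<dots> = foldr (\<lambda>i t. \<gamma> i *v t) is s"
    using assms by (simp add: sum.delta' del: subseqs.simps)
  finally show ?thesis .
qed

lemma clifford_act_e2:
  assumes "[i, j] \<in> set (subseqs [1, 2, 3, 4, 5, 6, 7])"
  shows "clifford_act \<gamma> e (e i \<and>\<^sub>f e j) p s = \<gamma> i *v (\<gamma> j *v s)"
  using clifford_act_coframe_prod[OF assms]
  by (simp add: coframe_prod_Cons coframe_prod_Nil wedge_one_right)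

lemma clifford_act_e3:
  assumes "[i, j, k] \<in> set (subseqs [1, 2, 3, 4, 5, 6, 7])"
  shows "clifford_act \<gamma> e (e i \<and>\<^sub>f e j \<and>\<^sub>f e k) p s = \<gamma> i *v (\<gamma> j *v (\<gamma> k *v s))"
  using clifford_act_coframe_prod[OF assms]
  by (simp add: coframe_prod_Cons coframe_prod_Nil wedge_one_right)

end

section \<open>The heterotic equations\<close>

context heis_frame
begin

section \<open>The connection with torsion\<close>

lemma frame_comp_flux:
  assumes "i \<in> {1..7}" "j \<in> {1..7}" "k \<in> {1..7}"
  shows "frame_comp e flux [i, j, k] p = w i j * kdelta k 7 + w j k * kdelta i 7 + w k i * kdelta j 7"
  using assms
  by (simp add: flux_eq_e frame_comp_linear frame_comp_e3 rot_kdelta kdelta_sym[of 7] algebra_simps)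

text \<open>At E_m, the Koszul terms with \<open>kdelta i 7\<close> and \<open>kdelta j 7\<close>
  cancel against half the torsion, while the two terms with \<open>kdelta m 7\<close> are equal
  halves of \<open>w j i\<close>. The reversed index order accounts for the negative
  parameters.\<close>

lemma add_torsion_lc:
  "add_torsion e lc_connection flux = heis_connection e (- a) (- b) (- c)"
proof (intro ext)
  fix i j
  show "add_torsion e lc_connection flux i j p vs = heis_connection e (- a) (- b) (- c) i j p vs" for p vs
  proof (cases "i \<in> {1..7} \<and> j \<in> {1..7}")
    case False
    then show ?thesis
      by (auto simp: add_torsion_def lc_connection_def heis_connection_eq rot_outside fmult_def)
  next
    case True
    let ?I = "\<lambda>\<omega> p vs. \<omega> p (vs @ [frame e j p, frame e i p])"
    have "?I flux = smult_form a (?I (e 1 \<and>\<^sub>f e 2 \<and>\<^sub>f e 7)) + smult_form b (?I (e 3 \<and>\<^sub>f e 4 \<and>\<^sub>f e 7))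
        + smult_form c (?I (e 5 \<and>\<^sub>f e 6 \<and>\<^sub>f e 7))"
      by (intro ext) (simp add: flux_eq_e fmult_def)
    then have I: "one_form (?I flux)"
      by (simp add: one_form_add one_form_smult one_form_wedge3_insert one_form_e)
    have eq: "add_torsion e lc_connection flux i j = lc_connection i j + smult_form (1/2) (?I flux)"
      using True by (intro ext) (simp add: add_torsion_def fmult_def)
    have "add_torsion e lc_connection flux i j = heis_connection e (- a) (- b) (- c) i j"
    proof (rule one_form_eqI)
      show "one_form (add_torsion e lc_connection flux i j)"
        unfolding eq by (intro one_form_add one_form_lc one_form_smult I)
      show "one_form (heis_connection e (- a) (- b) (- c) i j)"
        by (simp add: heis_connection_eq one_form_smult one_form_e)
      fix p and m :: nat assume m: "m \<in> {1..7}"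
      have "add_torsion e lc_connection flux i j p [frame e m p]
          = lc i m j + (w m j * kdelta i 7 + w j i * kdelta m 7 + w i m * kdelta j 7) / 2"
        using True m frame_comp_flux[of m j i p]
        by (simp add: eq fmult_def lc_connection_frame frame_comp_def)
      also have "\<dots> = w j i * kdelta m 7"
        using rot_skew[of a b c i m] by (simp add: lc_def field_simps)
      also have "\<dots> = heis_connection e (- a) (- b) (- c) i j p [frame e m p]"
        using m by (simp add: heis_connection_eq rot_uminus fmult_def e_frame kdelta_sym[of 7])
      finally show "add_torsion e lc_connection flux i j p [frame e m p]
          = heis_connection e (- a) (- b) (- c) i j p [frame e m p]" .
    qed
    then show ?thesis by simp
  qed
qed

section \<open>Curvature components and the Einstein equation\<close>

lemma frame_comp_ext_d_e:
  assumes "m \<in> {1..7}" "i \<in> {1..7}" "j \<in> {1..7}"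
  shows "frame_comp e (ext_d (e m)) [i, j] p = kdelta m 7 * w i j"
proof (cases "m = 7")
  case True
  then show ?thesis using assms by (simp add: frame_comp_de7 kdelta_def)
next
  case False
  then have "m \<in> {1..6}" using assms(1) by auto
  then show ?thesis using False by (simp add: ext_d_e frame_comp_zero kdelta_def)
qed

text \<open>The coefficients of the connection are constant and only de^7 is nonzero, so the
  derivative part involves only the coefficient of e^7.\<close>

lemma curv_comp_lc:
  assumes "i \<in> {1..7}" "j \<in> {1..7}" "k \<in> {1..7}" "l \<in> {1..7}"
  shows "curv_comp e lc_connection i j k l p
    = lc l 7 k * w i j + (\<Sum>m=1..7. lc l i m * lc m j k - lc l j m * lc m i k)"
proof -
  have "ext_d (lc_connection l k) = (\<Sum>m=1..7. smult_form (lc l m k) (ext_d (e m)))"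
    using assms ext_d_sum[of "{1..7}" "\<lambda>m. smult_form (lc l m k) (e m)"]
    by (simp add: lc_connection_def diff_form_smult diff_form_e ext_d_smult)
  then have "frame_comp e (ext_d (lc_connection l k)) [i, j] p = (\<Sum>m=1..7. lc l m k * (kdelta m 7 * w i j))"
    using assms by (simp add: frame_comp_linear frame_comp_ext_d_e)
  also have "\<dots> = lc l 7 k * w i j"
    by (simp add: sum_1_7 kdelta_def)
  finally have d: "frame_comp e (ext_d (lc_connection l k)) [i, j] p = lc l 7 k * w i j" .
  have "frame_comp e (lc_connection l m \<and>\<^sub>f lc_connection m k) [i, j] p
      = lc l i m * lc m j k - lc l j m * lc m i k" if "m \<in> {1..7}" for m
    using assms that by (simp add: frame_comp_def wedge_one_forms one_form_lc lc_connection_frame)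
  then show ?thesis
    by (simp add: curv_comp_def curvature_def frame_comp_linear d)
qed

text \<open>Vanishes for each k separately, which removes one of the two quadratic terms from the
  Ricci tensor.\<close>

lemma lc_trace: "lc k k m = 0"
  using rot_skew[of a b c k m] rot_skew[of a b c k k] by (simp add: lc_def kdelta_def rot_7)

lemma sum_kdelta_7: "(\<Sum>m=1..7. f m * kdelta m 7) = f 7"
  by (simp add: sum_1_7 kdelta_def)

lemma sum_w_square: "(\<Sum>m=1..7. \<Sum>n=1..7. (w m n)\<^sup>2) = 2 * (a\<^sup>2 + b\<^sup>2 + c\<^sup>2)"
  by (simp add: sum_1_7 rot_def)

definition ww :: "nat \<Rightarrow> nat \<Rightarrow> real" where
  "ww i j = (\<Sum>m=1..7. w i m * w j m)"

lemma ricci_lc: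
  assumes "i \<in> {1..7}" "j \<in> {1..7}"
  shows "ricci e lc_connection i j p
    = - ww i j / 2 + (a\<^sup>2 + b\<^sup>2 + c\<^sup>2) / 2 * (kdelta i 7 * kdelta j 7)"
proof -
  \<comment> \<open>Of the nine products only these three survive: in each of the others w receives
    an index 7. After summation the first and the third cancel.\<close>
  have L: "lc k i m * lc m k j = (w i k * w j k * kdelta m 7 - (w k m)\<^sup>2 * (kdelta i 7 * kdelta j 7)
      - w i m * w j m * kdelta k 7) / 4" for k m
    using rot_skew[of a b c k m] rot_skew[of a b c k j]
    by (cases "k = 7"; cases "m = 7"; cases "i = 7"; cases "j = 7")
      (simp_all add: lc_def kdelta_eval rot_7 power2_eq_square)
  have "(\<Sum>k=1..7. \<Sum>m=1..7. lc k i m * lc m k j)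
      = (ww i j - 2 * (a\<^sup>2 + b\<^sup>2 + c\<^sup>2) * (kdelta i 7 * kdelta j 7) - ww i j) / 4"
    unfolding L
    by (simp add: sum_subtractf sum_kdelta_7 sum_w_square
        flip: ww_def sum_divide_distrib sum_distrib_right)
  moreover have "(\<Sum>k=1..7. lc k 7 j * w k i) = - ww i j / 2"
  proof -
    have "lc k 7 j * w k i = - (w i k * w j k) / 2" for k
      using rot_skew[of a b c k i] by (simp add: lc_def kdelta_eval rot_7)
    then show ?thesis by (simp add: ww_def sum_negf flip: sum_divide_distrib)
  qed
  moreover have "ricci e lc_connection i j p
      = (\<Sum>k=1..7. lc k 7 j * w k i) - (\<Sum>k=1..7. \<Sum>m=1..7. lc k i m * lc m k j)"
    using assms by (simp add: ricci_def curv_comp_lc lc_trace sum_negf sum_subtractf)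
  ultimately show ?thesis by (simp add: field_simps)
qed

lemma flux_square:
  assumes "i \<in> {1..7}" "j \<in> {1..7}"
  shows "(\<Sum>m=1..7. \<Sum>n=1..7. frame_comp e flux [i, m, n] p * frame_comp e flux [j, m, n] p)
    = 2 * ww i j + 2 * (a\<^sup>2 + b\<^sup>2 + c\<^sup>2) * (kdelta i 7 * kdelta j 7)"
proof -
  have "(w i m * kdelta n 7 + w m n * kdelta i 7 + w n i * kdelta m 7)
      * (w j m * kdelta n 7 + w m n * kdelta j 7 + w n j * kdelta m 7)
    = w i m * w j m * kdelta n 7 + (w m n)\<^sup>2 * (kdelta i 7 * kdelta j 7) + w i n * w j n * kdelta m 7" for m n
    using rot_skew[of a b c n i] rot_skew[of a b c n j]
    by (cases "m = 7"; cases "n = 7"; cases "i = 7"; cases "j = 7")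
      (simp_all add: kdelta_eval rot_7 power2_eq_square)
  moreover have "(\<Sum>m=1..7. \<Sum>n=1..7. frame_comp e flux [i, m, n] p * frame_comp e flux [j, m, n] p)
      = (\<Sum>m=1..7. \<Sum>n=1..7. (w i m * kdelta n 7 + w m n * kdelta i 7 + w n i * kdelta m 7)
          * (w j m * kdelta n 7 + w m n * kdelta j 7 + w n j * kdelta m 7))"
    using assms by (simp add: frame_comp_flux)
  ultimately show ?thesis
    by (simp add: sum.distrib sum_kdelta_7 sum_w_square flip: ww_def sum_distrib_right)
qed

text \<open>The bundle indices k < q contribute the squared norm of the parameters, the form indices
  contribute W.\<close>

lemma curvature_square:
  assumes "i \<in> {1..7}" "j \<in> {1..7}"
  shows "(\<Sum>m=1..7. \<Sum>k=1..7. \<Sum>q\<in>{k<..7}. curv_comp e (heis_connection e x y z) i m k q p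
      * curv_comp e (heis_connection e x y z) j m k q p) = (x\<^sup>2 + y\<^sup>2 + z\<^sup>2) * ww i j"
proof -
  have "curv_comp e (heis_connection e x y z) i m k q p * curv_comp e (heis_connection e x y z) j m k q p
      = (rot x y z k q)\<^sup>2 * (w i m * w j m)" if "m \<in> {1..7}" for m k q
    using assms that rot_skew[of x y z k q]
    by (simp add: curv_comp_def curvature_heis_connection frame_comp_smult frame_comp_de7 power2_eq_square)
  then have "(\<Sum>m=1..7. \<Sum>k=1..7. \<Sum>q\<in>{k<..7}. curv_comp e (heis_connection e x y z) i m k q p
      * curv_comp e (heis_connection e x y z) j m k q p)
    = (\<Sum>m=1..7. \<Sum>k=1..7. \<Sum>q\<in>{k<..7}. (rot x y z k q)\<^sup>2 * (w i m * w j m))"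
    by (intro sum.cong refl)
  also have "\<dots> = (x\<^sup>2 + y\<^sup>2 + z\<^sup>2) * ww i j"
    by (simp only: sum_distrib_right[symmetric] sum_distrib_left[symmetric] sum_rot_square ww_def)
  finally show ?thesis .
qed

lemma einstein:
  assumes "l\<^sup>2 + m\<^sup>2 + t\<^sup>2 < 2 * (a\<^sup>2 + a * b + b\<^sup>2)"
  shows "einstein_eq (4 / (2 * (a\<^sup>2 + a * b + b\<^sup>2) - l\<^sup>2 - m\<^sup>2 - t\<^sup>2)) e flux
    (heis_connection e (- a) (- b) (- c)) (heis_connection e l m t)"
proof -
  define D where "D = 2 * (a\<^sup>2 + a * b + b\<^sup>2) - l\<^sup>2 - m\<^sup>2 - t\<^sup>2"
  have c: "c = - a - b" using abc by simp
  have D: "l\<^sup>2 + m\<^sup>2 + t\<^sup>2 = a\<^sup>2 + b\<^sup>2 + c\<^sup>2 - D"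
    by (simp add: D_def c power2_eq_square algebra_simps)
  have D0: "D > 0" using assms by (simp add: D_def)
  \<comment> \<open>S stands for W_ij and d for its e^7 part. The d-terms of Ricci and flux cancel;
    the S-terms add up to -S, and the bracket, equal to -D S, is multiplied by -1/D.\<close>
  have eq: "- S / 2 + (a\<^sup>2 + b\<^sup>2 + c\<^sup>2) / 2 * d - 1 / 4 * (2 * S + 2 * (a\<^sup>2 + b\<^sup>2 + c\<^sup>2) * d)
      - 4 / D / 4 * ((l\<^sup>2 + m\<^sup>2 + t\<^sup>2) * S - (a\<^sup>2 + b\<^sup>2 + c\<^sup>2) * S) = 0" for S d
    unfolding D using D0 by (simp add: field_simps)
  show ?thesis
    unfolding einstein_eq_def D_def[symmetric] levi_civita_eq
  proof (intro allI ballI)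
    fix p and i j :: nat assume ij: "i \<in> {1..7}" "j \<in> {1..7}"
    show "ricci e lc_connection i j p
      - 1/4 * (\<Sum>m=1..7. \<Sum>n=1..7. frame_comp e flux [i, m, n] p * frame_comp e flux [j, m, n] p)
      - 4 / D / 4 * ((\<Sum>n=1..7. \<Sum>k=1..7. \<Sum>q\<in>{k<..7}. curv_comp e (heis_connection e l m t) i n k q p
            * curv_comp e (heis_connection e l m t) j n k q p)
        - (\<Sum>n=1..7. \<Sum>k=1..7. \<Sum>q\<in>{k<..7}. curv_comp e (heis_connection e (- a) (- b) (- c)) i n k q p
            * curv_comp e (heis_connection e (- a) (- b) (- c)) j n k q p)) = 0"
      unfolding ricci_lc[OF ij] flux_square[OF ij] curvature_square[OF ij] power2_minus
      by (rule eq)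
  qed
qed

section \<open>The flux and gauge equations\<close>

lemma frechet_derivative_frame_comp_flux:
  assumes "set is \<subseteq> {1..7}" "length is = 3"
  shows "frechet_derivative (frame_comp e flux is) (at p) = (\<lambda>v. 0)"
proof -
  obtain i j k where "is = [i, j, k]"
    using assms(2) by (auto simp: numeral_3_eq_3 length_Suc_conv)
  then have "frame_comp e flux is = (\<lambda>p. w i j * kdelta k 7 + w j k * kdelta i 7 + w k i * kdelta j 7)"
    using assms(1) by (auto simp: frame_comp_flux)
  then show ?thesis by simp
qed

lemma flux_equation: "flux_eq e flux"
proof -
  have sum3: "(\<Sum>r<3::nat. f r) = f 0 + f 1 + f 2" for f :: "nat \<Rightarrow> real"
    by (simp add: numeral_3_eq_3 numeral_2_eq_2 One_nat_def)
  have "nabla_form e lc_connection flux i [i, j, k] p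
      = - (\<Sum>q=1..7. lc q i i * frame_comp e flux [q, j, k] p + lc q i j * frame_comp e flux [i, q, k] p
            + lc q i k * frame_comp e flux [i, j, q] p)"
    if "i \<in> {1..7}" "j \<in> {1..7}" "k \<in> {1..7}" for i j k p
    using that
    by (simp add: nabla_form_def frechet_derivative_frame_comp_flux sum3 lc_connection_frame sum.distrib
        One_nat_def numeral_2_eq_2)
  moreover have "(\<Sum>i=1..7. - (\<Sum>q=1..7. lc q i i * frame_comp e flux [q, j, k] p
      + lc q i j * frame_comp e flux [i, q, k] p + lc q i k * frame_comp e flux [i, j, q] p)) = 0"
    if jk: "j \<in> {1..7}" "k \<in> {1..7}" for j k p
  proof -
    let ?t = "\<lambda>i j k. w i j * kdelta k 7 + w j k * kdelta i 7 + w k i * kdelta j 7"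
    have L: "lc q i j * ?t i q k = ((w i q)\<^sup>2 * (kdelta j 7 * kdelta k 7) - w j q * w k q * kdelta i 7
        + w j i * w k i * kdelta q 7) / 2" for q i j k
      using rot_skew[of a b c i j] rot_skew[of a b c q k]
      by (cases "q = 7"; cases "i = 7"; cases "j = 7"; cases "k = 7")
        (simp_all add: lc_def kdelta_eval rot_7 power2_eq_square)
    \<comment> \<open>The point is that the result is symmetric in j and k: the two W-sums from
      \<open>L\<close> cancel.\<close>
    have S: "(\<Sum>i=1..7. \<Sum>q=1..7. lc q i j * ?t i q k) = (a\<^sup>2 + b\<^sup>2 + c\<^sup>2) * (kdelta j 7 * kdelta k 7)"
      for j k
      unfolding L by (simp add: sum.distrib sum_subtractf sum_kdelta_7 sum_w_square
          flip: ww_def sum_divide_distrib sum_distrib_right)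
    have lc0: "lc q i i = 0" for q i
      by (cases "i = 7") (simp_all add: lc_def kdelta_eval rot_7 rot_diag)
    have t_skew: "?t i j q = - ?t i q j" for i j q
      using rot_skew[of a b c i j] rot_skew[of a b c j q] rot_skew[of a b c q i] by simp
    \<comment> \<open>The first term vanishes because \<open>lc q i i\<close> does, and skewness of
      T makes the third the negative of the second with j and k exchanged. By \<open>S\<close> their
      sums cancel.\<close>
    have "lc q i i * ?t q j k + lc q i j * ?t i q k + lc q i k * ?t i j q
        = lc q i j * ?t i q k - lc q i k * ?t i q j" for i q
      unfolding lc0 t_skew[of i j q] mult_minus_right mult_zero_left add_0_left
      by (rule diff_conv_add_uminus[symmetric])
    then have "(\<Sum>i=1..7. \<Sum>q=1..7. lc q i i * ?t q j k + lc q i j * ?t i q k + lc q i k * ?t i j q)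
        = (\<Sum>i=1..7. \<Sum>q=1..7. lc q i j * ?t i q k) - (\<Sum>i=1..7. \<Sum>q=1..7. lc q i k * ?t i q j)"
      unfolding sum_subtractf[symmetric] by (intro sum.cong refl)
    then have "(\<Sum>i=1..7. \<Sum>q=1..7. lc q i i * ?t q j k + lc q i j * ?t i q k + lc q i k * ?t i j q) = 0"
      unfolding S mult.commute[of "kdelta k 7" "kdelta j 7"] by (rule trans) (rule diff_self)
    moreover have "(\<Sum>i=1..7. - (\<Sum>q=1..7. lc q i i * frame_comp e flux [q, j, k] p
        + lc q i j * frame_comp e flux [i, q, k] p + lc q i k * frame_comp e flux [i, j, q] p))
      = (\<Sum>i=1..7. - (\<Sum>q=1..7. lc q i i * ?t q j k + lc q i j * ?t i q k + lc q i k * ?t i j q))"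
      using jk by (intro sum.cong refl arg_cong[where f = uminus]) (simp only: frame_comp_flux)
    ultimately show ?thesis by (simp only: sum_negf neg_equal_0_iff_equal)
  qed
  ultimately show ?thesis
    by (simp add: flux_eq_def levi_civita_eq)
qed

text \<open>Every summand vanishes: the connection forms see only E_7, which annihilates the
  curvature and is fixed by the block matrices, and the commutator is that of proportional
  matrices.\<close>

lemma gauge_equation: "gauge_eq e (heis_connection e x y z) (heis_connection e l m t)"
proof -
  have conn: "heis_connection e x y z i j p [frame e k p] = rot x y z i j * kdelta 7 k" if "k \<in> {1..7}"
    for x y z i j k p
    using that by (simp add: heis_connection_eq fmult_def e_frame)
  have F: "frame_comp e (curvature (heis_connection e l m t) i j) [k, q] p = rot l m t i j * w k q"
    if "k \<in> {1..7}" "q \<in> {1..7}" for i j k q p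
    using that by (simp add: curvature_heis_connection frame_comp_smult frame_comp_de7)
  have dF: "frechet_derivative (frame_comp e (curvature (heis_connection e l m t) i j) [k, q]) (at p) = (\<lambda>v. 0)"
    if "k \<in> {1..7}" "q \<in> {1..7}" for i j k q p
  proof -
    have "frame_comp e (curvature (heis_connection e l m t) i j) [k, q] = (\<lambda>p. rot l m t i j * w k q)"
      using that by (auto simp: F)
    then show ?thesis by simp
  qed
  have sum2: "(\<Sum>r<2::nat. f r) = f 0 + f 1" for f :: "nat \<Rightarrow> real"
    by (simp add: numeral_2_eq_2 One_nat_def)
  have k0: "kdelta 7 i * w i j = 0" "rot x y z k i * kdelta 7 i = 0" for i j k
    by (simp_all add: kdelta_def rot_7)
  have "nabla_form e (heis_connection e x y z) (curvature (heis_connection e l m t) u v) i [i, j] p = 0"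
    if "i \<in> {1..7}" "j \<in> {1..7}" for u v i j p
  proof -
    have "rot x y z q j * kdelta 7 i * (rot l m t u v * w i q) = 0" for q
      using k0(1)[of i q] by auto
    then show ?thesis
      using that k0(2)
      by (simp add: nabla_form_def dF sum2 conn F One_nat_def sum.neutral)
  qed
  moreover have "rot l m t u k * kdelta 7 i * (rot l m t k v * w i j)
      - rot l m t u k * w i j * (rot l m t k v * kdelta 7 i) = 0" for u k i j v
    by simp
  ultimately show ?thesis
    by (simp add: gauge_eq_def conn F)
qed

text \<open>This fixes the sign in the octonion product: with e_j e_k = -Theta_jkl e_l for j, k
  distinct, the real part of e_i (e_j e_k) is +Theta_ijk. Skewness moves e_i to the other side, and
  only j is split into cases, i and k staying symbolic in Kronecker deltas.\<close>

lemma frame_comp_Theta_octonion: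
  assumes "i \<in> {1..7}" "j \<in> {1..7}" "k \<in> {1..7}"
  shows "frame_comp e Theta [i, j, k] p
    = octonion_mult i (octonion_mult j (octonion_mult k octonion_one)) \<bullet> octonion_one"
proof -
  have "\<forall>j\<in>{1..7}. frame_comp e Theta [i, j, k] p
      = - (octonion_mult j (octonion_mult k octonion_one) \<bullet> octonion_mult i octonion_one)"
    unfolding ball_1_7 octonion_mult_one[OF assms(1)] octonion_mult_one[OF assms(3)]
    using assms(1,3)
    by (simp add: Theta_eq frame_comp_linear frame_comp_e3 kdelta_eval octonion_mult_def
        inner_vec_def sum_8 algebra_simps)
  then show ?thesis using assms(2) by (simp add: octonion_mult_skew)
qed

lemma killing_spinor:
  "killing_spinor_eqs e Theta (heis_connection e (- a) (- b) (- c)) flux (\<lambda>_. \<phi>\<^sub>0) (heis_connection e l m t)"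
proof -
  have c: "c = - a - b" using abc by simp
  have spin: "spin_nabla octonion_gamma (heis_connection e (- a) (- b) (- c)) (\<lambda>_. octonion_one) p v = 0" for p v
  proof -
    \<comment> \<open>The products e_1 e_2, e_3 e_4 and e_5 e_6 are all -e_7, so the sum is a
      multiple of a + b + c.\<close>
    have "(\<Sum>i=1..7. \<Sum>j=1..7. rot (- a) (- b) (- c) i j *\<^sub>R octonion_mult i (octonion_mult j octonion_one)) = 0"
      unfolding sum_1_7
      by (simp add: rot_def vec_eq_iff forall_8 octonion_mult_def octonion_one_def c)
    then have "(\<Sum>i=1..7. \<Sum>j=1..7. e 7 p [v] *\<^sub>R rot (- a) (- b) (- c) i j *\<^sub>R octonion_mult i (octonion_mult j octonion_one)) = 0"
      by (simp only: scaleR_sum_right[symmetric] scaleR_zero_right)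
    then show ?thesis
      by (simp add: spin_nabla_def octonion_gamma_mult heis_connection_eq fmult_def mult.commute)
  qed
  \<comment> \<open>Likewise e_1(e_2 e_7), e_3(e_4 e_7) and e_5(e_6 e_7) all equal 1, which gives a
    + b + c times the spinor.\<close>
  have flux: "clifford_act octonion_gamma e flux p octonion_one = 0" for p
    by (simp add: flux_eq_e clifford_act_add clifford_act_smult clifford_act_e3 Let_def octonion_gamma_mult
        vec_eq_iff forall_8 octonion_mult_def octonion_one_def c)
  have de7: "clifford_act octonion_gamma e (ext_d (e 7)) p octonion_one = 0" for p
    by (simp add: ext_d_e7 clifford_act_add clifford_act_smult clifford_act_e2 Let_def octonion_gamma_mult
        vec_eq_iff forall_8 octonion_mult_def octonion_one_def c)
  have one: "octonion_one \<noteq> 0"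
    by (simp add: octonion_one_def vec_eq_iff forall_8)
  show ?thesis
    unfolding killing_spinor_eqs_def
  proof (intro exI[of _ octonion_gamma] exI[of _ "\<lambda>_. octonion_one"] conjI allI ballI)
    show "clifford_module octonion_gamma" by (rule clifford_module_octonion)
    show "clifford_act octonion_gamma e (ext_d (fn_form (\<lambda>_. \<phi>\<^sub>0)) - smult_form (1 / 2) flux) p octonion_one = 0" for p
      using clifford_act_smult[of _ e "- (1 / 2)" flux]
      by (simp add: ext_d_const flux smult_form_uminus)
    show "clifford_act octonion_gamma e (curvature (heis_connection e l m t) i j) p octonion_one = 0" for p i j
      by (simp add: curvature_heis_connection clifford_act_smult de7)
  qed (use one spin in \<open>simp_all add: octonion_gamma_mult frame_comp_Theta_octonion\<close>)
qed

end

section \<open>The left-invariant coframe of \<open>H(3,1)\<close>\<close>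

lemma exhaust_5:
  fixes x :: 5
  shows "x = 1 \<or> x = 2 \<or> x = 3 \<or> x = 4 \<or> x = 5"
proof (induct x)
  case (of_int z)
  then have "0 \<le> z" and "z < 5" by simp_all
  then have "z = 0 \<or> z = 1 \<or> z = 2 \<or> z = 3 \<or> z = 4" by arith
  then show ?case by auto
qed

lemma forall_5: "(\<forall>i::5. P i) \<longleftrightarrow> P 1 \<and> P 2 \<and> P 3 \<and> P 4 \<and> P 5"
  by (metis exhaust_5)

lemma UNIV_5: "UNIV = {1, 2, 3, 4, 5::5}"
  using exhaust_5 by auto

lemma sum_5: "sum f (UNIV::5 set) = f 1 + f 2 + f 3 + f 4 + f 5"
  unfolding UNIV_5 by (simp add: ac_simps)

lemma vector_5 [simp]:
  fixes x1 :: "'x::zero"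
  shows "(vector [x1, x2, x3, x4, x5] :: 'x^5) $ 1 = x1"
    "(vector [x1, x2, x3, x4, x5] :: 'x^5) $ 2 = x2"
    "(vector [x1, x2, x3, x4, x5] :: 'x^5) $ 3 = x3"
    "(vector [x1, x2, x3, x4, x5] :: 'x^5) $ 4 = x4"
    "(vector [x1, x2, x3, x4, x5] :: 'x^5) $ 5 = x5"
  unfolding vector_def by simp_all

section \<open>The group law, the lattice and compactness of the quotient\<close>

definition heis_mult :: "chart \<Rightarrow> chart \<Rightarrow> chart" where
  "heis_mult p q = (fst p + fst q, fst (snd p) + fst (snd q),
     snd (snd p) + snd (snd q) + fst p \<bullet> fst (snd q))"

definition heis_inv :: "chart \<Rightarrow> chart" where
  "heis_inv p = (- fst p, - fst (snd p), fst p \<bullet> fst (snd p) - snd (snd p))"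

lemma inj_heis_mat: "inj heis_mat"
  by (rule injI) (auto simp: heis_mat_def vec_eq_iff forall_5 forall_3)

lemma heis_mat_mult: "heis_mat p ** heis_mat q = heis_mat (heis_mult p q)"
  by (simp add: heis_mat_def heis_mult_def matrix_matrix_mult_def vec_eq_iff forall_5 sum_5
      inner_vec_def sum_3 split: prod.splits)

lemma heis_mat_zero: "heis_mat 0 = mat 1"
  by (simp add: heis_mat_def zero_prod_def mat_def vec_eq_iff forall_5)

lemma heis_inv_mult: "heis_mult (heis_inv p) p = 0"
  by (simp add: heis_mult_def heis_inv_def zero_prod_def inner_minus_left)

lemma left_trans_heis_mat: "left_trans (heis_mat q) p = heis_mult q p"
  by (simp add: left_trans_def heis_mat_mult inv_into_f_f[OF inj_heis_mat])

lemma heis_group_simps: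
  "carrier heis_group = range heis_mat" "M \<otimes>\<^bsub>heis_group\<^esub> N = M ** N" "\<one>\<^bsub>heis_group\<^esub> = mat 1"
  by (simp_all add: heis_group_def)

lemma group_heis_group: "group heis_group"
proof (rule groupI)
  show "\<one>\<^bsub>heis_group\<^esub> \<in> carrier heis_group"
    unfolding heis_group_simps heis_mat_zero[symmetric] by blast
  fix M assume "M \<in> carrier heis_group"
  then obtain p where "M = heis_mat p" by (auto simp: heis_group_simps)
  then have "heis_mat (heis_inv p) \<otimes>\<^bsub>heis_group\<^esub> M = \<one>\<^bsub>heis_group\<^esub>"
    by (simp add: heis_group_simps heis_mat_mult heis_inv_mult heis_mat_zero)
  then show "\<exists>N\<in>carrier heis_group. N \<otimes>\<^bsub>heis_group\<^esub> M = \<one>\<^bsub>heis_group\<^esub>"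
    by (intro bexI[of _ "heis_mat (heis_inv p)"]) (simp_all add: heis_group_simps)
qed (auto simp: heis_group_simps heis_mat_mult matrix_mul_assoc)

definition integral_chart :: "chart set" where
  "integral_chart = {p. (\<forall>i. fst p $ i \<in> \<int>) \<and> (\<forall>i. fst (snd p) $ i \<in> \<int>) \<and> snd (snd p) \<in> \<int>}"

lemma heis_lattice_eq: "heis_lattice = heis_mat ` integral_chart"
proof -
  have "(\<forall>i j. heis_mat p $ i $ j \<in> \<int>) \<longleftrightarrow> p \<in> integral_chart" for p
    by (auto simp: integral_chart_def heis_mat_def forall_5 forall_3 split: prod.splits)
  then show ?thesis unfolding heis_lattice_def heis_group_simps by blast
qed

lemma inner_integral: "(\<And>i. x $ i \<in> \<int>) \<Longrightarrow> (\<And>i. y $ i \<in> \<int>) \<Longrightarrow> x \<bullet> y \<in> \<int>"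
  for x y :: "real^'n"
  by (simp add: inner_vec_def Ints_sum)

lemma inv_heis_mat: "inv\<^bsub>heis_group\<^esub> (heis_mat p) = heis_mat (heis_inv p)"
  using group.inv_equality[OF group_heis_group, of "heis_mat (heis_inv p)" "heis_mat p"]
  by (simp add: heis_group_simps heis_mat_mult heis_inv_mult heis_mat_zero)

lemma subgroup_heis_lattice: "subgroup heis_lattice heis_group"
proof (rule group.subgroupI[OF group_heis_group])
  show "heis_lattice \<subseteq> carrier heis_group" by (simp add: heis_lattice_def)
  have "0 \<in> integral_chart" by (simp add: integral_chart_def)
  then show "heis_lattice \<noteq> {}" by (auto simp: heis_lattice_eq)
next
  fix M assume "M \<in> heis_lattice"
  then obtain p where p: "M = heis_mat p" "p \<in> integral_chart" by (auto simp: heis_lattice_eq)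
  then have "heis_inv p \<in> integral_chart"
    by (simp add: integral_chart_def heis_inv_def inner_integral)
  then show "inv\<^bsub>heis_group\<^esub> M \<in> heis_lattice"
    by (simp add: p inv_heis_mat heis_lattice_eq)
next
  fix M N assume "M \<in> heis_lattice" "N \<in> heis_lattice"
  then obtain p q where pq: "M = heis_mat p" "p \<in> integral_chart" "N = heis_mat q" "q \<in> integral_chart"
    by (auto simp: heis_lattice_eq)
  then have "heis_mult p q \<in> integral_chart"
    by (simp add: integral_chart_def heis_mult_def inner_integral)
  then show "M \<otimes>\<^bsub>heis_group\<^esub> N \<in> heis_lattice"
    by (simp add: pq heis_group_simps heis_mat_mult heis_lattice_eq)
qed

text \<open>\<open>topology\<close> returns the given predicate only if it is an
  \<open>istopology\<close>; this holds because preimages under the projection commute with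
  intersections and unions.\<close>

lemma openin_heis_nilmanifold:
  "openin heis_nilmanifold U \<longleftrightarrow> U \<subseteq> rcosets\<^bsub>heis_group\<^esub> heis_lattice \<and>
     openin (top_of_set (carrier heis_group))
       {M \<in> carrier heis_group. heis_lattice #>\<^bsub>heis_group\<^esub> M \<in> U}"
proof -
  let ?V = "\<lambda>U. {M \<in> carrier heis_group. heis_lattice #>\<^bsub>heis_group\<^esub> M \<in> U}"
  let ?P = "\<lambda>U. U \<subseteq> rcosets\<^bsub>heis_group\<^esub> heis_lattice \<and>
     openin (top_of_set (carrier heis_group)) (?V U)"
  have "istopology ?P"
    unfolding istopology_def
  proof (intro conjI allI impI)
    fix S T assume ST: "?P S" "?P T"
    then show "S \<inter> T \<subseteq> rcosets\<^bsub>heis_group\<^esub> heis_lattice" by blast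
    have eq: "?V (S \<inter> T) = ?V S \<inter> ?V T" by blast
    show "openin (top_of_set (carrier heis_group)) (?V (S \<inter> T))"
      unfolding eq by (intro openin_Int conjunct2[OF ST(1)] conjunct2[OF ST(2)])
  next
    fix \<K> assume K: "Ball \<K> ?P"
    then show "\<Union>\<K> \<subseteq> rcosets\<^bsub>heis_group\<^esub> heis_lattice" by blast
    have eq: "?V (\<Union>\<K>) = (\<Union>S\<in>\<K>. ?V S)" by blast
    show "openin (top_of_set (carrier heis_group)) (?V (\<Union>\<K>))"
      unfolding eq
    proof (rule openin_Union)
      fix W assume "W \<in> ?V ` \<K>"
      then obtain S where "S \<in> \<K>" "W = ?V S" by (elim imageE)
      then show "openin (top_of_set (carrier heis_group)) W"
        using K by (simp only: Ball_def)
    qed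
  qed
  from topology_inverse'[OF this] show ?thesis
    by (simp add: heis_nilmanifold_def)
qed

lemma topspace_heis_nilmanifold: "topspace heis_nilmanifold = rcosets\<^bsub>heis_group\<^esub> heis_lattice"
proof
  show "topspace heis_nilmanifold \<subseteq> rcosets\<^bsub>heis_group\<^esub> heis_lattice"
    using openin_topspace[of heis_nilmanifold] by (simp only: openin_heis_nilmanifold)
  have "{M \<in> carrier heis_group. heis_lattice #>\<^bsub>heis_group\<^esub> M \<in> rcosets\<^bsub>heis_group\<^esub> heis_lattice}
      = carrier heis_group" by (auto simp: RCOSETS_def)
  then have "openin heis_nilmanifold (rcosets\<^bsub>heis_group\<^esub> heis_lattice)"
    by (simp add: openin_heis_nilmanifold)
  then show "rcosets\<^bsub>heis_group\<^esub> heis_lattice \<subseteq> topspace heis_nilmanifold"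
    by (rule openin_subset)
qed

lemma continuous_heis_mat: "continuous_on S heis_mat"
proof -
  have "continuous_on S (\<lambda>p. heis_mat p $ i $ j)" for i j
  proof -
    have "\<forall>i j. continuous_on S (\<lambda>p. heis_mat p $ i $ j)"
      unfolding heis_mat_def forall_5 case_prod_beta
      by (simp add: continuous_intros)
    then show ?thesis by blast
  qed
  then have "continuous_on S (\<lambda>p. \<chi> i. \<chi> j. heis_mat p $ i $ j)"
    by (intro continuous_on_vec_lambda)
  then show ?thesis by simp
qed

text \<open>The unit cube of the chart meets every coset of the lattice.\<close>

lemma compact_space_heis_nilmanifold: "compact_space heis_nilmanifold"
proof -
  let ?q = "\<lambda>M. heis_lattice #>\<^bsub>heis_group\<^esub> M"
  define C :: "chart set" where "C = cbox 0 (vec 1) \<times> cbox 0 (vec 1) \<times> {0..1}"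
  have "compact C"
    unfolding C_def by (intro compact_Times compact_cbox compact_Icc)
  then have "compact (heis_mat ` C)"
    by (rule compact_continuous_image[OF continuous_heis_mat])
  then have "compactin (top_of_set (carrier heis_group)) (heis_mat ` C)"
    by (auto simp: compactin_subtopology heis_group_simps)
  moreover have "continuous_map (top_of_set (carrier heis_group)) heis_nilmanifold ?q"
    unfolding continuous_map_def
    by (auto simp: openin_heis_nilmanifold topspace_heis_nilmanifold RCOSETS_def)
  ultimately have "compactin heis_nilmanifold (?q ` heis_mat ` C)"
    by (rule image_compactin)
  moreover have "?q ` heis_mat ` C = topspace heis_nilmanifold"
  proof
    show "?q ` heis_mat ` C \<subseteq> topspace heis_nilmanifold"
      by (auto simp: topspace_heis_nilmanifold RCOSETS_def heis_group_simps)
    show "topspace heis_nilmanifold \<subseteq> ?q ` heis_mat ` C"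
    proof
      fix X assume "X \<in> topspace heis_nilmanifold"
      then obtain p where X: "X = ?q (heis_mat p)"
        by (auto simp: topspace_heis_nilmanifold RCOSETS_def heis_group_simps)
      \<comment> \<open>Left multiplication by (m, n, k) adds m and n to x and y, but shifts z by k
        plus the inner product of m and y. So k is chosen after m, from the floor of the shifted
        z.\<close>
      define m :: "real^3" where "m = (\<chi> i. - of_int \<lfloor>fst p $ i\<rfloor>)"
      define n :: "real^3" where "n = (\<chi> i. - of_int \<lfloor>fst (snd p) $ i\<rfloor>)"
      define k where "k = (- of_int \<lfloor>snd (snd p) + m \<bullet> fst (snd p)\<rfloor> :: real)"
      have mn: "m $ i = - of_int \<lfloor>fst p $ i\<rfloor>" "n $ i = - of_int \<lfloor>fst (snd p) $ i\<rfloor>" for i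
        by (simp_all add: m_def n_def)
      have g: "(m, n, k) \<in> integral_chart"
        by (simp add: integral_chart_def mn k_def)
      have "0 \<le> - of_int \<lfloor>x\<rfloor> + x" "- of_int \<lfloor>x\<rfloor> + x \<le> 1" for x :: real
        by linarith+
      from this[of "snd (snd p) + m \<bullet> fst (snd p)"] this
      have "heis_mult (m, n, k) p \<in> C"
        by (simp add: C_def heis_mult_def mem_box_cart mn k_def algebra_simps)
      moreover have "X = ?q (heis_mat (heis_mult (m, n, k) p))"
      proof -
        have "?q (heis_mat (m, n, k)) = heis_lattice"
          using g by (intro subgroup.rcos_const[OF subgroup_heis_lattice group_heis_group])
            (simp add: heis_lattice_eq)
        then have "X = ?q (heis_mat (m, n, k)) #>\<^bsub>heis_group\<^esub> heis_mat p"
          by (simp add: X)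
        also have "\<dots> = ?q (heis_mat (m, n, k) \<otimes>\<^bsub>heis_group\<^esub> heis_mat p)"
          using subgroup.subset[OF subgroup_heis_lattice]
          by (intro group.coset_mult_assoc[OF group_heis_group]) (auto simp: heis_group_simps)
        finally show ?thesis by (simp add: heis_group_simps heis_mat_mult)
      qed
      ultimately show "X \<in> ?q ` heis_mat ` C" by blast
    qed
  qed
  ultimately show ?thesis by (simp add: compact_space_def)
qed

section \<open>The coframe and its dual frame in coordinates\<close>

lemma ext_d_fn_form: "ext_d (fn_form f) p vs = (if length vs = 1 then frechet_derivative f (at p) (hd vs) else 0)"
proof (cases vs)
  case Nil
  then show ?thesis by (simp add: ext_d_Nil)
next
  case (Cons v ws)
  show ?thesis
  proof (cases ws)
    case Nil
    then show ?thesis using Cons by (simp add: ext_d_def fn_form_def One_nat_def)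
  next
    case (Cons u us)
    have "fn_form f q (take i vs @ drop (Suc i) vs) = 0" for i q
      using \<open>vs = v # ws\<close> Cons by (cases i) (simp_all add: fn_form_def)
    then show ?thesis
      using \<open>vs = v # ws\<close> Cons by (simp add: ext_d_def frechet_derivative_zero One_nat_def)
  qed
qed

lemma frechet_derivative_linear:
  fixes f :: "'v::euclidean_space \<Rightarrow> 'w::real_normed_vector"
  assumes "linear f"
  shows "frechet_derivative f (at p) = f"
  using assms by (metis frechet_derivative_at bounded_linear_imp_has_derivative linear_conv_bounded_linear)

lemma dx_apply: "dx i p vs = (if length vs = 1 then fst (hd vs) $ i else 0)"
  and dy_apply: "dy i p vs = (if length vs = 1 then fst (snd (hd vs)) $ i else 0)"
  and dz_apply: "dz p vs = (if length vs = 1 then snd (snd (hd vs)) else 0)"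
  unfolding dx_def dy_def dz_def ext_d_fn_form
  by (subst frechet_derivative_linear; simp add: linear_iff case_prod_beta)+

lemma contact_form_apply:
  "contact_form p vs = (if length vs = 1 then fst p \<bullet> fst (snd (hd vs)) - snd (snd (hd vs)) else 0)"
  by (simp add: contact_form_def sum_form_apply fmult_def dy_apply dz_apply inner_vec_def case_prod_beta)

lemma heis_coframe_eq:
  "heis_coframe a b c 1 p [v] = fst v $ 1 / a" "heis_coframe a b c 2 p [v] = fst (snd v) $ 1"
  "heis_coframe a b c 3 p [v] = fst v $ 2 / b" "heis_coframe a b c 4 p [v] = fst (snd v) $ 2"
  "heis_coframe a b c 5 p [v] = fst v $ 3 / c" "heis_coframe a b c 6 p [v] = fst (snd v) $ 3"
  "heis_coframe a b c 7 p [v] = fst p \<bullet> fst (snd v) - snd (snd v)"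
  by (simp_all add: heis_coframe_def fmult_def dx_apply dy_apply contact_form_apply One_nat_def)

lemma heis_coframe_length: "length vs \<noteq> 1 \<Longrightarrow> heis_coframe a b c i p vs = 0"
  by (simp add: heis_coframe_def fmult_def dx_apply dy_apply contact_form_apply)

lemma one_form_heis_coframe: "i \<in> {1..7} \<Longrightarrow> one_form (heis_coframe a b c i)"
proof -
  have "\<forall>i\<in>{1..7}. linear (\<lambda>v. heis_coframe a b c i p [v])" for p
    unfolding ball_1_7 heis_coframe_eq
    by (simp add: linear_iff add_divide_distrib inner_add_right algebra_simps)
  then show "i \<in> {1..7} \<Longrightarrow> one_form (heis_coframe a b c i)"
    by (simp add: one_form_def heis_coframe_length)
qed

lemma singleton_list_cases: "(\<And>v. vs = [v] \<Longrightarrow> P) \<Longrightarrow> (length vs \<noteq> 1 \<Longrightarrow> P) \<Longrightarrow> P"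
  by (cases vs; cases "tl vs") (auto simp: One_nat_def)

lemma heis_coframe_const:
  assumes "i \<in> {1..6}" shows "heis_coframe a b c i p vs = heis_coframe a b c i q vs"
proof -
  have "i \<in> {1, 2, 3, 4, 5, 6}" using assms by auto
  then show ?thesis
    by (cases vs rule: singleton_list_cases) (auto simp: heis_coframe_eq heis_coframe_length)
qed

lemma diff_form_const: "(\<And>p q vs. \<omega> p vs = \<omega> q vs) \<Longrightarrow> diff_form \<omega>"
proof -
  assume "\<And>p q vs. \<omega> p vs = \<omega> q vs"
  then have "(\<lambda>q. \<omega> q vs) = (\<lambda>_. \<omega> 0 vs)" for vs by blast
  then show "diff_form \<omega>" by (simp add: diff_form_def)
qed

lemma ext_d_const_form: "(\<And>p q vs. \<omega> p vs = \<omega> q vs) \<Longrightarrow> ext_d \<omega> = 0"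
proof (intro ext)
  fix p vs
  assume "\<And>p q vs. \<omega> p vs = \<omega> q vs"
  then have "(\<lambda>q. \<omega> q vs) = (\<lambda>_. \<omega> 0 vs)" for vs by blast
  then have "frechet_derivative (\<lambda>q. \<omega> q ws) (at p) v = 0" for ws v
    by (metis frechet_derivative_const)
  then show "ext_d \<omega> p vs = 0 p vs" by (simp add: ext_d_def)
qed

lemma has_derivative_contact_form:
  "((\<lambda>q. heis_coframe a b c 7 q [v]) has_derivative (\<lambda>u. fst u \<bullet> fst (snd v))) (at p)"
  unfolding heis_coframe_eq by (auto intro!: derivative_eq_intros)

lemma diff_form_heis_coframe: "i \<in> {1..7} \<Longrightarrow> diff_form (heis_coframe a b c i)"
proof (cases "i = 7")
  case True
  have "(\<lambda>q. heis_coframe a b c 7 q vs) differentiable at p" for p vs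
  proof (cases vs rule: singleton_list_cases)
    case (1 v)
    show ?thesis unfolding 1 differentiable_def by (rule exI, rule has_derivative_contact_form)
  next
    case 2
    then show ?thesis by (simp add: heis_coframe_length)
  qed
  then show ?thesis using True by (simp add: diff_form_def)
next
  case False
  assume "i \<in> {1..7}"
  with False have "i \<in> {1..6}" by auto
  then show ?thesis by (intro diff_form_const heis_coframe_const)
qed

text \<open>The scalings undo the 1/a, 1/b, 1/c of the coframe; the z-components x_i of the even
  fields make them annihilated by the contact form, and its -dz forces the sign of E_7. The final
  \<open>else\<close> is meant for index 7.\<close>

definition heis_frame_field :: "real \<Rightarrow> real \<Rightarrow> real \<Rightarrow> nat \<Rightarrow> chart \<Rightarrow> chart" where
  "heis_frame_field a b c i p =
     (if i = 1 then (vector [a, 0, 0], 0, 0) else if i = 2 then (0, vector [1, 0, 0], fst p $ 1)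
      else if i = 3 then (vector [0, b, 0], 0, 0) else if i = 4 then (0, vector [0, 1, 0], fst p $ 2)
      else if i = 5 then (vector [0, 0, c], 0, 0) else if i = 6 then (0, vector [0, 0, 1], fst p $ 3)
      else (0, 0, - 1))"

lemma heis_coframe_frame_field:
  assumes "a \<noteq> 0" "b \<noteq> 0" "c \<noteq> 0"
  shows "\<forall>i\<in>{1..7}. \<forall>j\<in>{1..7}. heis_coframe a b c j p [heis_frame_field a b c i p] = (if j = i then 1 else 0)"
  unfolding ball_1_7
  using assms by (simp add: heis_coframe_eq heis_frame_field_def inner_vec_def sum_3)

lemma heis_coframe_eqI:
  assumes "a \<noteq> 0" "b \<noteq> 0" "c \<noteq> 0"
    and "\<And>j. j \<in> {1..7} \<Longrightarrow> heis_coframe a b c j p [u] = heis_coframe a b c j p [v]"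
  shows "u = v"
proof -
  have "\<forall>j\<in>{1..7}. heis_coframe a b c j p [u] = heis_coframe a b c j p [v]" using assms(4) by blast
  then have *: "fst u = fst v" "fst (snd u) = fst (snd v)"
    "fst p \<bullet> fst (snd u) - snd (snd u) = fst p \<bullet> fst (snd v) - snd (snd v)"
    unfolding ball_1_7 heis_coframe_eq using assms(1-3) by (simp_all add: vec_eq_iff forall_3)
  then show ?thesis by (simp add: prod_eq_iff)
qed

lemma coframe_heis_coframe:
  assumes "a \<noteq> 0" "b \<noteq> 0" "c \<noteq> 0"
  shows "coframe (heis_coframe a b c)"
proof
  fix i :: nat and p assume "i \<in> {1..7}"
  then show "\<exists>!v. \<forall>j\<in>{1..7}. heis_coframe a b c j p [v] = (if j = i then 1 else 0)"
    using heis_coframe_frame_field[OF assms, of p]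
    by (intro ex1I[of _ "heis_frame_field a b c i p"] heis_coframe_eqI[OF assms, of p]) simp_all
qed (simp_all only: one_form_heis_coframe diff_form_heis_coframe)

lemma frame_heis_coframe:
  assumes "a \<noteq> 0" "b \<noteq> 0" "c \<noteq> 0" "i \<in> {1..7}"
  shows "frame (heis_coframe a b c) i = heis_frame_field a b c i"
proof
  fix p
  interpret coframe "heis_coframe a b c" by (rule coframe_heis_coframe) fact+
  show "frame (heis_coframe a b c) i p = heis_frame_field a b c i p"
    using heis_coframe_frame_field[OF assms(1-3), of p] assms(4)
    by (intro heis_coframe_eqI[OF assms(1-3), of p]) (simp add: e_frame kdelta_def)
qed

lemma frechet_derivative_heis_frame_field:
  assumes "i \<in> {1..7}"
  shows "frechet_derivative (heis_frame_field a b c i) (at p) v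
    = (0, 0, if i = 2 then fst v $ 1 else if i = 4 then fst v $ 2 else if i = 6 then fst v $ 3 else 0)"
proof -
  have "((\<lambda>p. (0::real^3, u::real^3, fst p $ k)) has_derivative (\<lambda>v. (0, 0, fst v $ k))) (at p)"
    for u k and p :: chart
    by (auto intro!: derivative_eq_intros bounded_linear.has_derivative[OF bounded_linear_vec_nth])
  note d = frechet_derivative_at[OF this, THEN fun_cong, symmetric]
  have "i \<in> {1, 2, 3, 4, 5, 6, 7}" using assms by auto
  then show ?thesis
    by (auto simp: heis_frame_field_def[abs_def] d frechet_derivative_const[THEN fun_cong] zero_prod_def)
qed

lemma lie_bracket_heis_frame_field:
  assumes "i \<in> {1..7}" "j \<in> {1..7}"
  shows "lie_bracket (heis_frame_field a b c i) (heis_frame_field a b c j) p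
    = - rot a b c i j *\<^sub>R heis_frame_field a b c 7 p"
proof -
  have "\<forall>i\<in>{1..7}. \<forall>j\<in>{1..7}. lie_bracket (heis_frame_field a b c i) (heis_frame_field a b c j) p
    = - rot a b c i j *\<^sub>R heis_frame_field a b c 7 p"
    unfolding ball_1_7
    by (simp add: lie_bracket_def frechet_derivative_heis_frame_field)
      (simp add: heis_frame_field_def rot_def zero_prod_def)
  then show ?thesis using assms by blast
qed

text \<open>The contact form has derivative sum of dx_i wedge dy_i; the factors a, b, c cancel the
  scalings of e^1, e^3, e^5.\<close>

lemma ext_d_contact_form:
  assumes "a \<noteq> 0" "b \<noteq> 0" "c \<noteq> 0"
  defines "e \<equiv> heis_coframe a b c"
  shows "ext_d (e 7) = smult_form a (e 1 \<and>\<^sub>f e 2) + smult_form b (e 3 \<and>\<^sub>f e 4) + smult_form c (e 5 \<and>\<^sub>f e 6)"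
    (is "_ = ?R")
proof (intro ext)
  fix p and vs :: "chart list"
  have one: "one_form (e i)" if "i \<in> {1..7}" for i
    using that by (simp add: e_def one_form_heis_coframe)
  show "ext_d (e 7) p vs = ?R p vs"
  proof (cases "length vs = 2")
    case True
    then obtain u v where vs: "vs = [u, v]" by (auto simp: numeral_2_eq_2 length_Suc_conv)
    have "ext_d (e 7) p [u, v] = fst u \<bullet> fst (snd v) - fst v \<bullet> fst (snd u)"
      by (simp add: ext_d_Cons ext_d_Nil dir_deriv_def contract_def e_def
          frechet_derivative_at[OF has_derivative_contact_form, symmetric])
    also have "\<dots> = ?R p [u, v]"
      using assms(1-3)
      by (simp add: fmult_def wedge_one_forms one) (simp add: e_def heis_coframe_eq inner_vec_def sum_3 field_simps)
    finally show ?thesis by (simp only: vs)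
  next
    case False
    \<comment> \<open>Equality of forms also concerns lists of the wrong length, where both sides
      have to be shown to vanish.\<close>
    have "(e i \<and>\<^sub>f e j) p vs = 0" if "i \<in> {1..7}" "j \<in> {1..7}" for i j
    proof (rule wedge_degree[where n = 1, OF one[OF that(1)]])
      show "e j p ws = 0" if "length ws \<noteq> 1" for ws
        using one[OF \<open>j \<in> {1..7}\<close>] that unfolding one_form_def by blast
    qed (use False in simp)
    then have R: "?R p vs = 0" by (simp add: fmult_def)
    have "e 7 q (take i vs @ drop (Suc i) vs) = 0" if "i < length vs" for i q
      using False that by (auto simp: e_def intro!: heis_coframe_length)
    then have "ext_d (e 7) p vs = 0"
      by (simp add: ext_d_def frechet_derivative_zero)
    then show ?thesis by (simp only: R)
  qed
qed

lemma heis_frame_heis_coframe: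
  assumes "a \<noteq> 0" "b \<noteq> 0" "c \<noteq> 0" "a + b + c = 0"
  shows "heis_frame (heis_coframe a b c) a b c"
proof -
  interpret coframe "heis_coframe a b c" by (rule coframe_heis_coframe) fact+
  show ?thesis
  proof
    show "ext_d (heis_coframe a b c i) = 0" if "i \<in> {1..6}" for i
      using that by (intro ext_d_const_form heis_coframe_const)
  qed (use assms in \<open>simp_all add: ext_d_contact_form frame_heis_coframe lie_bracket_heis_frame_field\<close>)
qed


subsection \<open>Invariance\<close>

lemma trans_invariant_heis_coframe:
  assumes "i \<in> {1..7}"
  shows "trans_invariant (carrier heis_group) (heis_coframe a b c i)"
  unfolding trans_invariant_def
proof (intro ballI ext)
  fix M p and vs :: "chart list" assume "M \<in> carrier heis_group"
  then obtain q where M: "M = heis_mat q" by (auto simp: heis_group_simps)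
  have "left_trans M = (\<lambda>p. heis_mult q p)"
    by (intro ext) (simp add: M left_trans_heis_mat)
  \<comment> \<open>The derivative adds the inner product of the x-part of q with dy to dz, which
    compensates the shift of x in the contact form.\<close>
  moreover have "((\<lambda>p. heis_mult q p) has_derivative
      (\<lambda>v. (fst v, fst (snd v), snd (snd v) + fst q \<bullet> fst (snd v)))) (at p)"
    unfolding heis_mult_def by (auto intro!: derivative_eq_intros)
  ultimately have d: "frechet_derivative (left_trans M) (at p)
      = (\<lambda>v. (fst v, fst (snd v), snd (snd v) + fst q \<bullet> fst (snd v)))"
    by (simp only: frechet_derivative_at[symmetric])
  have "i \<in> {1, 2, 3, 4, 5, 6, 7}" using assms by auto
  then show "pullback (left_trans M) (heis_coframe a b c i) p vs = heis_coframe a b c i p vs"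
    by (cases vs rule: singleton_list_cases)
      (auto simp: pullback_def d[unfolded M] M left_trans_heis_mat heis_coframe_eq heis_coframe_length heis_mult_def
        inner_add_left)
qed

lemma trans_invariant_add: "trans_invariant S \<omega> \<Longrightarrow> trans_invariant S \<eta> \<Longrightarrow> trans_invariant S (\<omega> + \<eta>)"
  and trans_invariant_diff: "trans_invariant S \<omega> \<Longrightarrow> trans_invariant S \<eta> \<Longrightarrow> trans_invariant S (\<omega> - \<eta>)"
  and trans_invariant_smult: "trans_invariant S \<omega> \<Longrightarrow> trans_invariant S (smult_form r \<omega>)"
  by (simp_all add: trans_invariant_def pullback_def fun_eq_iff fmult_def)

lemma trans_invariant_wedge:
  "trans_invariant S \<omega> \<Longrightarrow> trans_invariant S \<eta> \<Longrightarrow> trans_invariant S (\<omega> \<and>\<^sub>f \<eta>)"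
  by (simp add: trans_invariant_def pullback_wedge)

lemma trans_invariant_mono: "trans_invariant S \<omega> \<Longrightarrow> R \<subseteq> S \<Longrightarrow> trans_invariant R \<omega>"
  by (auto simp: trans_invariant_def)

theorem theorem5p8:
  fixes a b c lam mu tau \<alpha>' \<phi>\<^sub>0 :: real
    and e :: "nat \<Rightarrow> chart form" and \<Theta> T :: "chart form"
    and nabla_plus A :: "chart connection"
  assumes "a \<noteq> 0" and "b \<noteq> 0" and "a + b \<noteq> 0" and "c = - (a + b)"
    and "e = heis_coframe a b c"
    and "\<Theta> = G2_form e"
    and "T = - hodge e (ext_d \<Theta>)"
    and "nabla_plus = add_torsion e (levi_civita e) T"
    and "A = heis_connection e lam mu tau"
    and "(lam, mu, tau) \<noteq> (0, 0, 0)"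
    and "lam\<^sup>2 + mu\<^sup>2 + tau\<^sup>2 < 2 * (a\<^sup>2 + a * b + b\<^sup>2)"
    and "\<alpha>' = 4 / (2 * (a\<^sup>2 + a * b + b\<^sup>2) - lam\<^sup>2 - mu\<^sup>2 - tau\<^sup>2)"
  shows
    "group heis_group \<and> subgroup heis_lattice heis_group \<and>
     topspace heis_nilmanifold = rcosets\<^bsub>heis_group\<^esub> heis_lattice \<and>
     compact_space heis_nilmanifold \<and>
     (\<forall>i\<in>{1..7}. one_form (e i) \<and> trans_invariant (carrier heis_group) (e i)) \<and>
     trans_invariant heis_lattice \<Theta> \<and> trans_invariant heis_lattice T \<and>
     (\<forall>i j. trans_invariant heis_lattice (nabla_plus i j) \<and> trans_invariant heis_lattice (A i j)) \<and>
     connection_forms nabla_plus \<and> connection_forms A \<and>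
     (\<forall>i\<in>{1..6}. ext_d (e i) = 0) \<and>
     ext_d (e 7) = smult_form a (coframe_prod e [1, 2]) + smult_form b (coframe_prod e [3, 4])
                   - smult_form (a + b) (coframe_prod e [5, 6]) \<and>
     cocalibrated_pure_type e \<Theta> \<and>
     G2_instanton e \<Theta> A \<and>
     killing_spinor_eqs e \<Theta> nabla_plus T (\<lambda>_. \<phi>\<^sub>0) A \<and>
     \<alpha>' > 0 \<and> anomaly_cancellation \<alpha>' T nabla_plus A \<and>
     heterotic_eom \<alpha>' e T nabla_plus A \<and>
     (\<forall>p u v. metric e p u v =
        1 / a\<^sup>2 * sym_square (dx 1) p u v + sym_square (dy 1) p u v
      + 1 / b\<^sup>2 * sym_square (dx 2) p u v + sym_square (dy 2) p u v
      + 1 / (a + b)\<^sup>2 * sym_square (dx 3) p u v + sym_square (dy 3) p u v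
      + sym_square contact_form p u v)"
proof -
  have c: "c \<noteq> 0" "a + b + c = 0" using assms(3,4) by simp_all
  interpret heis_frame e a b c
    unfolding \<open>e = heis_coframe a b c\<close> by (rule heis_frame_heis_coframe) fact+
  have \<Theta>: "\<Theta> = Theta" by (simp add: Theta_def assms(6))
  have T: "T = flux" by (simp add: flux_def assms(7) \<Theta>)
  have nabla: "nabla_plus = heis_connection e (- a) (- b) (- c)"
    by (simp add: assms(8) T levi_civita_eq add_torsion_lc)
  have inv: "trans_invariant (carrier heis_group) (e i)" if "i \<in> {1..7}" for i
    using that by (simp add: assms(5) trans_invariant_heis_coframe)
  have inv': "trans_invariant heis_lattice (e i)" if "i \<in> {1..7}" for i
    by (rule trans_invariant_mono[OF inv[OF that]]) (simp add: heis_lattice_def)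
  \<comment> \<open>Arbitrary parameters, so that one statement covers A and, through
    \<open>nabla\<close>, also the connection with torsion.\<close>
  have conn_inv: "trans_invariant heis_lattice (heis_connection e x y z i j)" for x y z i j
    by (simp add: heis_connection_eq trans_invariant_smult inv')
  have conn: "connection_forms (heis_connection e x y z)" for x y z
    by (auto simp: connection_forms_def heis_connection_eq rot_outside smult_form_zero
        intro!: one_form_smult one_form_e)
  have metric: "metric e p u v =
        1 / a\<^sup>2 * sym_square (dx 1) p u v + sym_square (dy 1) p u v
      + 1 / b\<^sup>2 * sym_square (dx 2) p u v + sym_square (dy 2) p u v
      + 1 / (a + b)\<^sup>2 * sym_square (dx 3) p u v + sym_square (dy 3) p u v
      + sym_square contact_form p u v" for p u v
  proof -
    have "(a + b)\<^sup>2 = c\<^sup>2" by (simp add: assms(4) power2_eq_square algebra_simps)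
    then show ?thesis
      by (simp add: metric_def sum_1_7 assms(5) heis_coframe_eq sym_square_def dx_apply dy_apply
          contact_form_apply power2_eq_square)
  qed
  show ?thesis
  proof (intro conjI ballI allI)
    show "group heis_group" by (rule group_heis_group)
    show "subgroup heis_lattice heis_group" by (rule subgroup_heis_lattice)
    show "topspace heis_nilmanifold = rcosets\<^bsub>heis_group\<^esub> heis_lattice"
      by (rule topspace_heis_nilmanifold)
    show "compact_space heis_nilmanifold" by (rule compact_space_heis_nilmanifold)
    show "trans_invariant heis_lattice \<Theta>"
      unfolding \<Theta> Theta_eq
      by (intro trans_invariant_add trans_invariant_diff trans_invariant_wedge inv') simp_all
    show "trans_invariant heis_lattice T"
      unfolding T flux_eq_e
      by (intro trans_invariant_add trans_invariant_smult trans_invariant_wedge inv') simp_all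
    show "ext_d (e 7) = smult_form a (coframe_prod e [1, 2]) + smult_form b (coframe_prod e [3, 4])
        - smult_form (a + b) (coframe_prod e [5, 6])"
      using smult_form_uminus[of "a + b" "e 5 \<and>\<^sub>f e 6"]
      by (simp add: ext_d_e7 assms(4) coframe_prod_Cons coframe_prod_Nil wedge_one_right)
    show "\<alpha>' > 0" using assms(11,12) by simp
    show "cocalibrated_pure_type e \<Theta>" unfolding \<Theta> by (rule cocalibrated)
    show "G2_instanton e \<Theta> A" unfolding \<Theta> assms(9) by (rule instanton)
    show "killing_spinor_eqs e \<Theta> nabla_plus T (\<lambda>_. \<phi>\<^sub>0) A"
      unfolding \<Theta> T nabla assms(9) by (rule killing_spinor)
    show "anomaly_cancellation \<alpha>' T nabla_plus A"
      unfolding T nabla assms(9,12) using assms(11) by (rule anomaly)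
    show "heterotic_eom \<alpha>' e T nabla_plus A"
      unfolding T nabla assms(9,12) heterotic_eom_def
      using einstein[OF assms(11)] flux_equation gauge_equation by blast
  qed (simp_all only: one_form_e inv conn conn_inv nabla assms(9) ext_d_e metric)
qed

end
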